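(* Let $Z_1,\ldots,Z_n\in\mathbb{R}^d$ be i.i.d. with distribution $F$, $Z\sim F$. Let $\hat\theta$ and $\hat\theta_{(-i)}$ be the solutions to $\sum_{j=1}^n\varphi(Z_j,\theta)=0$ and $\sum_{j\ne i}\varphi(Z_j,\theta)=0$, respectively. Assume further that $\hat\theta,\hat\theta_{(-i)}\in\Theta\subseteq\mathbb{R}^p$ where $\Theta$ is compact, and that there exist functions $m_0,m_1,p_1$ and $p_2$ bounding the norms of $\varphi$, all partial derivatives of $\varphi$ with respect to $\theta$, $\psi$, and all partial derivatives of $\psi$ with respect to $\theta$, respectively. Then, for a given function $\psi(z,\theta)$, $$\frac1n\sum_{i=1}^n\psi(Z_i,\hat\theta_{(-i)})=\frac1n\sum_{i=1}^n\psi(Z_i,\hat\theta)-\frac1n\mathrm{Tr}(J^{-1}C)+o_p(1/n),$$ where $J=-\partial_{\theta=\theta_0}\mathrm{E}\,\varphi(Z,\theta)$ and $C=\mathrm{E}\,\varphi(Z,\theta_0)\{\nabla_{\theta=\theta_0}\psi(Z,\theta)\}^T$, with $\theta_0$ being the solution to $\mathrm{E}\,\varphi(Z,\theta)=0$, provided the eigenvalues of $\{\partial_\theta\mathrm{E}\,\varphi(Z,\theta)\}^{-1}$ are bounded in $\Theta$ and $\mathrm{E}\,m_0(Z)^4,\ \mathrm{E}\,m_1(Z)^4,\ \mathrm{E}\,p_1(Z)^4,\ \mathrm{E}\,p_2(Z)^2<\infty$.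
   Context: $\varphi(z,\theta)$ takes values in $\mathbb{R}^p$ and $\psi(z,\theta)$ in $\mathbb{R}$, for $z\in\mathbb{R}^d$ and $\theta\in\Theta$, with the derivatives appearing existing. The bounding functions $m_0,m_1,p_1,p_2$ are functions of $z$. $\partial_\theta$ denotes the Jacobian matrix, $\nabla$ the gradient and $\mathrm{Tr}$ the trace.
   Formalization: The theta-derivatives of φ and ψ are assumed continuous at θ_0 (if they merely exist the claim fails, e.g. φ=z−θ, ψ=zθ² sin(1/θ), Z=±1), and θ_0 is assumed to be an interior point of Θ, so that the derivatives there are well defined. *)

theory Defs
  imports "HOL-Probability.Probability"
begin

(* The measurability clause is essential: measure assigns 0 to a non-measurable event,
   so without it the limit could hold for no good reason. *)
definition small_o_p :: "'w measure \<Rightarrow> (nat \<Rightarrow> 'w \<Rightarrow> real) \<Rightarrow> (nat \<Rightarrow> real) \<Rightarrow> bool" where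
  "small_o_p M X r \<longleftrightarrow>
     (\<forall>n. X n \<in> borel_measurable M) \<and>
     (\<forall>\<epsilon>>0. (\<lambda>n. measure M {\<omega> \<in> space M. \<bar>X n \<omega>\<bar> > \<epsilon> * \<bar>r n\<bar>}) \<longlonglongrightarrow> 0)"

(* Complex eigenvalues, since the Jacobian need not be symmetric. *)
definition complex_eigenvalue :: "real^'p^'p \<Rightarrow> complex \<Rightarrow> bool" where
  "complex_eigenvalue A c \<longleftrightarrow>
     (\<exists>v :: complex^'p. v \<noteq> 0 \<and> map_matrix complex_of_real A *v v = c *s v)"

end

theory Submission
  imports Defs
begin

text \<open>
  Write \<open>\<Delta>\<^sub>i\<close> for the displacement of the \<open>i\<close>-th leave-one-out estimator from the full one.
  All estimators are simultaneously close to \<open>\<theta>\<^sub>0\<close>: the sample score is bounded away from 0 outside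
  any ball around \<open>\<theta>\<^sub>0\<close> (Wald's compactness argument), while it equals 0 at the full estimator and
  \<open>\<phi>(Z\<^sub>i, \<cdot>)/n\<close> at the \<open>i\<close>-th leave-one-out estimator, which is uniformly small because
  \<open>max\<^sub>i m\<^sub>0(Z\<^sub>i)\<^sup>2 \<le> \<Sum>\<^sub>j m\<^sub>0(Z\<^sub>j)\<^sup>2 = O(n)\<close>.  Subtracting the two estimating equations and using that the
  sample score is, near \<open>\<theta>\<^sub>0\<close>, strictly differentiable with derivative close to \<open>-J\<close> gives
  \<open>n\<Delta>\<^sub>i = -J\<^sup>-\<^sup>1 \<phi>(Z\<^sub>i, \<theta>\<^sub>0)\<close> up to an error controlled by envelopes of \<open>Z\<^sub>i\<close>.  Linearising \<open>\<psi>\<close>, the sum of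
  the differences \<open>\<psi>(Z\<^sub>i, \<theta>\<^sub>(\<^sub>-\<^sub>i\<^sub>)) - \<psi>(Z\<^sub>i, \<theta>hat)\<close> is therefore the sample mean of
  \<open>-\<nabla>\<psi>\<^sup>T J\<^sup>-\<^sup>1 \<phi>\<close> at \<open>\<theta>\<^sub>0\<close>, whose limit is \<open>-Tr(J\<^sup>-\<^sup>1 C)\<close>.

  Suprema over neighbourhoods are taken only of functions continuous in the parameter, hence over
  countable dense sets.  The derivatives of \<open>\<phi>\<close> and \<open>\<psi>\<close> are continuous only at \<open>\<theta>\<^sub>0\<close>, so the
  remainder quotients off the diagonal take the place of their moduli of continuity.
\<close>

section \<open>Events of probability tending to one\<close>

text \<open>
  ``With high probability'': exceptional events are measurable supersets, so that predicates
  need not be measurable themselves.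
\<close>

definition (in prob_space) whp :: "(nat \<Rightarrow> 'a \<Rightarrow> bool) \<Rightarrow> bool" where
  "whp P \<longleftrightarrow> (\<exists>B. (\<forall>n. B n \<in> events) \<and> (\<lambda>n. prob (B n)) \<longlonglongrightarrow> 0 \<and>
     (\<forall>n. \<forall>\<omega>\<in>space M - B n. P n \<omega>))"

context prob_space
begin

lemma whpI:
  assumes "\<And>n. B n \<in> events" "(\<lambda>n. prob (B n)) \<longlonglongrightarrow> 0"
    and "\<And>n \<omega>. \<omega> \<in> space M - B n \<Longrightarrow> P n \<omega>"
  shows "whp P"
  unfolding whp_def using assms by blast

lemma whp_eventually_mono:
  assumes "whp P" and "\<forall>\<^sub>F n in sequentially. \<forall>\<omega>\<in>space M. P n \<omega> \<longrightarrow> Q n \<omega>"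
  shows "whp Q"
proof -
  obtain B where B: "\<And>n. B n \<in> events" "(\<lambda>n. prob (B n)) \<longlonglongrightarrow> 0"
      "\<And>n \<omega>. \<omega> \<in> space M - B n \<Longrightarrow> P n \<omega>"
    using assms(1) unfolding whp_def by blast
  obtain N where N: "\<And>n \<omega>. n \<ge> N \<Longrightarrow> \<omega> \<in> space M \<Longrightarrow> P n \<omega> \<Longrightarrow> Q n \<omega>"
    using assms(2) unfolding eventually_sequentially by blast
  show ?thesis
  \<comment> \<open>The finitely many indices below \<open>N\<close> receive the whole space as
    exceptional event; this does not affect the limit of the probabilities.\<close>
  proof (rule whpI[where B = "\<lambda>n. if n < N then space M else B n"])
    show "(\<lambda>n. prob (if n < N then space M else B n)) \<longlonglongrightarrow> 0"
      by (rule Lim_transform_eventually[OF B(2)])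
        (auto intro!: eventually_mono[OF eventually_ge_at_top[of N]])
  qed (use B N in \<open>auto split: if_splits\<close>)
qed

lemma whp_mono:
  assumes "whp P" and "\<And>n \<omega>. \<omega> \<in> space M \<Longrightarrow> P n \<omega> \<Longrightarrow> Q n \<omega>"
  shows "whp Q"
  by (rule whp_eventually_mono[OF assms(1)]) (use assms(2) in auto)

lemma whp_conj:
  assumes "whp P" "whp Q"
  shows "whp (\<lambda>n \<omega>. P n \<omega> \<and> Q n \<omega>)"
proof -
  obtain A where A: "\<And>n. A n \<in> events" "(\<lambda>n. prob (A n)) \<longlonglongrightarrow> 0"
      "\<And>n \<omega>. \<omega> \<in> space M - A n \<Longrightarrow> P n \<omega>"
    using assms(1) unfolding whp_def by blast
  obtain B where B: "\<And>n. B n \<in> events" "(\<lambda>n. prob (B n)) \<longlonglongrightarrow> 0"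
      "\<And>n \<omega>. \<omega> \<in> space M - B n \<Longrightarrow> Q n \<omega>"
    using assms(2) unfolding whp_def by blast
  show ?thesis
  proof (rule whpI[where B = "\<lambda>n. A n \<union> B n"])
    have "(\<lambda>n. prob (A n) + prob (B n)) \<longlonglongrightarrow> 0"
      using tendsto_add[OF A(2) B(2)] by simp
    then show "(\<lambda>n. prob (A n \<union> B n)) \<longlonglongrightarrow> 0"
      by (rule Lim_null_comparison[rotated]) (auto intro!: always_eventually measure_Un_le A B)
  qed (use A B in auto)
qed

lemma whp_True: "whp (\<lambda>n \<omega>. True)"
  by (rule whpI[where B = "\<lambda>_. {}"]) auto

lemma whp_finite_Ball:
  assumes "finite I" and "\<And>i. i \<in> I \<Longrightarrow> whp (P i)"
  shows "whp (\<lambda>n \<omega>. \<forall>i\<in>I. P i n \<omega>)"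
  using assms
proof (induction I)
  case empty
  then show ?case by (simp add: whp_True)
next
  case (insert i I)
  then have "whp (\<lambda>n \<omega>. P i n \<omega> \<and> (\<forall>i\<in>I. P i n \<omega>))"
    by (intro whp_conj) auto
  then show ?case by simp
qed

text \<open>Almost sure validity supplies a measurable null set for each large \<open>n\<close>, and
  null sets are admissible exceptional events.\<close>

lemma whp_eventually_AE:
  assumes "\<forall>\<^sub>F n in sequentially. AE \<omega> in M. P n \<omega>"
  shows "whp P"
proof -
  \<comment> \<open>Putting the almost sure statement into a premise lets exceptional null sets be
    chosen for all \<open>n\<close> at once, with \<open>{}\<close> where the premise fails.\<close>
  have "whp (\<lambda>n \<omega>. (AE \<omega> in M. P n \<omega>) \<longrightarrow> P n \<omega>)"
  proof -
    have "\<exists>B\<in>events. prob B = 0 \<and> (\<forall>\<omega>\<in>space M - B. (AE \<omega> in M. P n \<omega>) \<longrightarrow> P n \<omega>)" for n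
    proof (cases "AE \<omega> in M. P n \<omega>")
      case True
      then obtain B where "{\<omega> \<in> space M. \<not> P n \<omega>} \<subseteq> B" "emeasure M B = 0" "B \<in> events"
        by (rule AE_E)
      then show ?thesis by (intro bexI[of _ B]) (auto simp: measure_def)
    qed (auto intro!: bexI[of _ "{}"])
    then obtain B where B: "\<And>n. B n \<in> events" "\<And>n. prob (B n) = 0"
      "\<And>n \<omega>. \<omega> \<in> space M - B n \<Longrightarrow> (AE \<omega> in M. P n \<omega>) \<longrightarrow> P n \<omega>"
      by metis
    show ?thesis by (rule whpI[OF B(1) _ B(3)]) (simp_all add: B(2))
  qed
  then show ?thesis
    by (rule whp_eventually_mono) (use assms in eventually_elim, auto)
qed

text \<open>Monotonicity of \<open>prob\<close> asks only the larger set to be measurable, so the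
  event itself may be arbitrary. This leads back from \<open>whp\<close> to the probabilities in
  \<open>small_o_p\<close>.\<close>

lemma whp_imp_prob_tendsto_0:
  assumes "whp (\<lambda>n \<omega>. \<not> P n \<omega>)"
  shows "(\<lambda>n. prob {\<omega>\<in>space M. P n \<omega>}) \<longlonglongrightarrow> 0"
proof -
  obtain B where B: "\<And>n. B n \<in> events" "(\<lambda>n. prob (B n)) \<longlonglongrightarrow> 0"
      "\<And>n \<omega>. \<omega> \<in> space M - B n \<Longrightarrow> \<not> P n \<omega>"
    using assms unfolding whp_def by blast
  have "prob {\<omega>\<in>space M. P n \<omega>} \<le> prob (B n)" for n
    using B by (intro finite_measure_mono) auto
  then show ?thesis
    by (intro Lim_null_comparison[OF _ B(2)]) auto
qed

lemma whp_Markov: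
  fixes X :: "nat \<Rightarrow> 'a \<Rightarrow> real"
  assumes X: "\<And>n. integrable M (X n)" "\<And>n \<omega>. \<omega> \<in> space M \<Longrightarrow> 0 \<le> X n \<omega>"
    and lim: "(\<lambda>n. expectation (X n)) \<longlonglongrightarrow> 0" and "0 < \<epsilon>"
  shows "whp (\<lambda>n \<omega>. X n \<omega> \<le> \<epsilon>)"
proof (rule whpI[where B = "\<lambda>n. {\<omega>\<in>space M. \<epsilon> \<le> X n \<omega>}"])
  have [measurable]: "X n \<in> borel_measurable M" for n
    using X(1) by auto
  show "{\<omega> \<in> space M. \<epsilon> \<le> X n \<omega>} \<in> events" for n
    by measurable
  have "prob {\<omega>\<in>space M. \<epsilon> \<le> X n \<omega>} \<le> expectation (X n) / \<epsilon>" for n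
    using X \<open>0 < \<epsilon>\<close> by (intro integral_Markov_inequality_measure[where A = "{}"]) auto
  then have *: "\<forall>\<^sub>F n in sequentially. norm (prob {\<omega>\<in>space M. \<epsilon> \<le> X n \<omega>}) \<le> expectation (X n) / \<epsilon>"
    by simp
  have "(\<lambda>n. expectation (X n) / \<epsilon>) \<longlonglongrightarrow> 0"
    using tendsto_divide[OF lim tendsto_const[of \<epsilon>]] \<open>0 < \<epsilon>\<close> by simp
  then show "(\<lambda>n. prob {\<omega>\<in>space M. \<epsilon> \<le> X n \<omega>}) \<longlonglongrightarrow> 0"
    by (rule Lim_null_comparison[OF *])
qed auto

end

subsection \<open>The weak law of large numbers\<close>

text \<open>The measure \<open>F\<close> has two roles: its sigma-algebra is the one on the space of
  observations, and as a measure it is their common law. Hence \<open>distr\<close> has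
  \<open>F\<close> as its target.\<close>

locale iid_sample = prob_space M for M :: "'w measure" +
  fixes F :: "'z measure" and Z :: "nat \<Rightarrow> 'w \<Rightarrow> 'z"
  assumes indep: "indep_vars (\<lambda>_. F) Z UNIV"
    and distr_Z: "distr M F (Z i) = F"
begin

lemma measurable_Z [measurable]: "Z i \<in> M \<rightarrow>\<^sub>M F"
  using indep by (auto simp: indep_vars_def)

sublocale F: prob_space F
  using prob_space_distr[OF measurable_Z[of 0]] by (simp add: distr_Z)

definition mean :: "('z \<Rightarrow> real) \<Rightarrow> nat \<Rightarrow> 'w \<Rightarrow> real" where
  "mean f n \<omega> = (\<Sum>j<n. f (Z j \<omega>)) / real n"

lemma integrable_sample:
  fixes f :: "'z \<Rightarrow> 'b::{banach, second_countable_topology}"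
  assumes "integrable F f"
  shows "integrable M (\<lambda>\<omega>. f (Z i \<omega>))"
  by (rule integrable_distr[OF measurable_Z]) (simp add: distr_Z assms)

lemma expectation_sample:
  fixes f :: "'z \<Rightarrow> 'b::{banach, second_countable_topology}"
  assumes "f \<in> borel_measurable F"
  shows "expectation (\<lambda>\<omega>. f (Z i \<omega>)) = (\<integral>z. f z \<partial>F)"
  using integral_distr[OF measurable_Z assms, of i] by (simp add: distr_Z)

text \<open>When the square is expanded, independence and centring annihilate the off-diagonal
  products, and only the \<open>n\<close> diagonal terms survive.\<close>

lemma expectation_square_centred_sum:
  fixes f :: "'z \<Rightarrow> real"
  assumes [measurable]: "f \<in> borel_measurable F" and bound: "\<And>z. \<bar>f z\<bar> \<le> K"
    and centred: "(\<integral>z. f z \<partial>F) = 0"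
  shows "expectation (\<lambda>\<omega>. (\<Sum>j<n. f (Z j \<omega>))\<^sup>2) \<le> n * K\<^sup>2"
proof -
  have K: "0 \<le> K" using bound[of undefined] by linarith
  have int: "integrable M (\<lambda>\<omega>. f (Z i \<omega>))" for i
    by (rule integrable_const_bound[where B = K]) (use bound in auto)
  have int2: "integrable M (\<lambda>\<omega>. f (Z i \<omega>) * f (Z j \<omega>))" for i j
    by (rule integrable_const_bound[where B = "K * K"])
      (use bound K in \<open>auto simp: abs_mult intro!: mult_mono\<close>)
  have off: "expectation (\<lambda>\<omega>. f (Z i \<omega>) * f (Z j \<omega>)) = 0" if "i \<noteq> j" for i j
  proof -
    have "indep_vars (\<lambda>_. borel) (\<lambda>i \<omega>. f (Z i \<omega>)) UNIV"
      by (rule indep_vars_compose2[OF indep]) auto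
    then have "indep_vars (\<lambda>_. borel) (\<lambda>i \<omega>. f (Z i \<omega>)) {i, j}"
      by (rule indep_vars_subset) auto
    then have "expectation (\<lambda>\<omega>. \<Prod>k\<in>{i, j}. f (Z k \<omega>)) = (\<Prod>k\<in>{i, j}. expectation (\<lambda>\<omega>. f (Z k \<omega>)))"
      by (intro indep_vars_lebesgue_integral) (auto simp: int)
    then show ?thesis
      using that by (simp add: expectation_sample centred)
  qed
  have diag: "expectation (\<lambda>\<omega>. f (Z i \<omega>) * f (Z i \<omega>)) \<le> K\<^sup>2" for i
  proof -
    have "expectation (\<lambda>\<omega>. f (Z i \<omega>) * f (Z i \<omega>)) \<le> expectation (\<lambda>_. K\<^sup>2)"
    proof (intro integral_mono int2)
      show "f (Z i \<omega>) * f (Z i \<omega>) \<le> K\<^sup>2" for \<omega>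
        using abs_le_square_iff[of "f (Z i \<omega>)" K] bound[of "Z i \<omega>"] K by (simp add: power2_eq_square)
    qed simp
    then show ?thesis by (simp add: prob_space)
  qed
  have "expectation (\<lambda>\<omega>. (\<Sum>j<n. f (Z j \<omega>))\<^sup>2)
      = (\<Sum>i<n. \<Sum>j<n. expectation (\<lambda>\<omega>. f (Z i \<omega>) * f (Z j \<omega>)))"
    by (simp add: power2_eq_square sum_product int2)
  also have "\<dots> = (\<Sum>i<n. \<Sum>j<n. if j = i then expectation (\<lambda>\<omega>. f (Z i \<omega>) * f (Z i \<omega>)) else 0)"
    by (intro sum.cong refl) (auto simp: off)
  also have "\<dots> = (\<Sum>i<n. expectation (\<lambda>\<omega>. f (Z i \<omega>) * f (Z i \<omega>)))"
    by (simp add: sum.delta)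
  also have "\<dots> \<le> (\<Sum>i<n. K\<^sup>2)"
    by (intro sum_mono diag)
  finally show ?thesis by simp
qed

lemma integrable_mean:
  assumes "integrable F f"
  shows "integrable M (mean f n)"
  unfolding mean_def[abs_def]
  by (intro integrable_divide Bochner_Integration.integrable_sum integrable_sample assms)

lemma expectation_mean:
  assumes "integrable F f" "n > 0"
  shows "expectation (mean f n) = (\<integral>z. f z \<partial>F)"
  using assms unfolding mean_def[abs_def]
  by (simp add: integrable_sample expectation_sample)

text \<open>A Chebyshev-type bound in L1 form. Centring at most doubles the bound \<open>K\<close>,
  so the second moment of the centred mean is at most \<open>(2 * K)\<^sup>2 / n\<close>; the free
  parameter \<open>\<eta>\<close> trades it for a first moment.\<close>

lemma expectation_abs_mean_bounded:
  assumes [measurable]: "f \<in> borel_measurable F" and bound: "\<And>z. \<bar>f z\<bar> \<le> K"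
    and "\<eta> > 0" "n > 0"
  shows "expectation (\<lambda>\<omega>. \<bar>mean f n \<omega> - (\<integral>z. f z \<partial>F)\<bar>) \<le> \<eta> + (2 * K)\<^sup>2 / \<eta> / n"
proof -
  define \<mu> where "\<mu> = (\<integral>z. f z \<partial>F)"
  have K: "0 \<le> K" using bound[of undefined] by linarith
  have int: "integrable F f"
    by (rule F.integrable_const_bound[where B = K]) (use bound in auto)
  have "\<bar>\<mu>\<bar> \<le> (\<integral>z. \<bar>f z\<bar> \<partial>F)"
    unfolding \<mu>_def by (rule integral_abs_bound)
  also have "\<dots> \<le> (\<integral>z. K \<partial>F)"
    using int by (intro integral_mono) (auto simp: bound)
  finally have \<mu>: "\<bar>\<mu>\<bar> \<le> K" by (simp add: F.prob_space)
  define g where "g z = f z - \<mu>" for z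
  have [measurable]: "g \<in> borel_measurable F" unfolding g_def by measurable
  have g: "\<bar>g z\<bar> \<le> 2 * K" for z
    using bound[of z] \<mu> unfolding g_def by linarith
  have gc: "(\<integral>z. g z \<partial>F) = 0"
    using int by (simp add: g_def \<mu>_def F.prob_space)
  have sq: "expectation (\<lambda>\<omega>. (\<Sum>j<n. g (Z j \<omega>))\<^sup>2) \<le> n * (2 * K)\<^sup>2"
    by (rule expectation_square_centred_sum) (use g gc in auto)
  have intsq: "integrable M (\<lambda>\<omega>. (\<Sum>j<n. g (Z j \<omega>))\<^sup>2)"
  proof (rule integrable_const_bound[where B = "(n * (2 * K))\<^sup>2"])
    have "\<bar>\<Sum>j<n. g (Z j \<omega>)\<bar> \<le> n * (2 * K)" for \<omega>
      by (rule order_trans[OF sum_abs]) (use sum_bounded_above[of "{..<n}" "\<lambda>j. \<bar>g (Z j \<omega>)\<bar>" "2 * K"] g in simp)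
    then show "AE \<omega> in M. norm ((\<Sum>j<n. g (Z j \<omega>))\<^sup>2) \<le> (n * (2 * K))\<^sup>2"
      by (auto intro!: abs_le_square_iff[THEN iffD1] order_trans[OF _ abs_ge_self])
  qed auto
  have "expectation (\<lambda>\<omega>. \<bar>mean f n \<omega> - \<mu>\<bar>) \<le> expectation (\<lambda>\<omega>. \<eta> + (\<Sum>j<n. g (Z j \<omega>))\<^sup>2 / (n\<^sup>2 * \<eta>))"
  proof (intro integral_mono)
    fix \<omega>
    \<comment> \<open>This comes from expanding the square of \<open>\<bar>x\<bar> - \<eta>\<close>
      and takes the place of the Cauchy-Schwarz inequality.\<close>
    have *: "\<bar>x\<bar> \<le> \<eta> + x\<^sup>2 / \<eta>" for x :: real
    proof -
      have "0 \<le> (\<bar>x\<bar> - \<eta>)\<^sup>2" by simp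
      then have "\<bar>x\<bar> * (2 * \<eta>) \<le> x\<^sup>2 + \<eta>\<^sup>2" by (simp add: power2_diff)
      moreover have "0 \<le> \<bar>x\<bar> * \<eta>" using \<open>\<eta> > 0\<close> by simp
      ultimately have "\<bar>x\<bar> * \<eta> \<le> \<eta> * \<eta> + x\<^sup>2" by (simp add: power2_eq_square)
      then show ?thesis using \<open>\<eta> > 0\<close> by (simp add: field_simps)
    qed
    have "mean f n \<omega> - \<mu> = (\<Sum>j<n. g (Z j \<omega>)) / n"
      using \<open>n > 0\<close> by (simp add: mean_def g_def sum_subtractf field_simps)
    then show "\<bar>mean f n \<omega> - \<mu>\<bar> \<le> \<eta> + (\<Sum>j<n. g (Z j \<omega>))\<^sup>2 / (n\<^sup>2 * \<eta>)"
      using *[of "(\<Sum>j<n. g (Z j \<omega>)) / n"] by (simp add: power_divide)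
  qed (use intsq int in \<open>auto intro!: integrable_mean\<close>)
  also have "\<dots> = \<eta> + expectation (\<lambda>\<omega>. (\<Sum>j<n. g (Z j \<omega>))\<^sup>2) / (n\<^sup>2 * \<eta>)"
    using intsq by (simp add: prob_space)
  also have "\<dots> \<le> \<eta> + n * (2 * K)\<^sup>2 / (n\<^sup>2 * \<eta>)"
    using \<open>\<eta> > 0\<close> by (intro add_left_mono divide_right_mono sq) auto
  also have "\<dots> = \<eta> + (2 * K)\<^sup>2 / \<eta> / n"
    using \<open>n > 0\<close> by (simp add: power2_eq_square)
  finally show ?thesis unfolding \<mu>_def .
qed

text \<open>Truncation at level \<open>k\<close> splits \<open>f\<close> into a bounded part, for
  which the second moment bound works, and a remainder \<open>r\<close> whose L1 norm is small by
  dominated convergence. Hence no second moment of \<open>f\<close> enters.\<close>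

lemma mean_tendsto_L1:
  assumes int: "integrable F f"
  shows "(\<lambda>n. expectation (\<lambda>\<omega>. \<bar>mean f n \<omega> - (\<integral>z. f z \<partial>F)\<bar>)) \<longlonglongrightarrow> 0"
proof (rule LIMSEQ_I)
  fix \<epsilon> :: real assume "\<epsilon> > 0"
  define t where "t k z = max (- real k) (min (real k) (f z))" for k z
  have [measurable]: "f \<in> borel_measurable F" using int by auto
  have [measurable]: "t k \<in> borel_measurable F" for k unfolding t_def by measurable
  have tb: "\<bar>t k z\<bar> \<le> k" for k z by (auto simp: t_def)
  have tf: "\<bar>t k z\<bar> \<le> \<bar>f z\<bar>" for k z by (auto simp: t_def)
  have ti: "integrable F (t k)" for k
    by (rule F.integrable_const_bound[where B = "real k"]) (use tb in auto)
  have "(\<lambda>k. \<integral>z. \<bar>f z - t k z\<bar> \<partial>F) \<longlonglongrightarrow> (\<integral>z. 0 \<partial>F)"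
  proof (rule integral_dominated_convergence[where w = "\<lambda>z. 2 * \<bar>f z\<bar>"])
    have "(\<lambda>k. \<bar>f z - t k z\<bar>) \<longlonglongrightarrow> 0" for z
    proof (rule tendsto_eventually)
      obtain N :: nat where "\<bar>f z\<bar> \<le> N" using real_arch_simple by blast
      then have "\<bar>f z - t k z\<bar> = 0" if "N \<le> k" for k
        using that by (auto simp: t_def max_def min_def)
      then show "\<forall>\<^sub>F k in sequentially. \<bar>f z - t k z\<bar> = 0"
        by (rule eventually_mono[OF eventually_ge_at_top[of N]])
    qed
    then show "AE z in F. (\<lambda>k. \<bar>f z - t k z\<bar>) \<longlonglongrightarrow> 0" by simp
    have "\<bar>f z - t k z\<bar> \<le> 2 * \<bar>f z\<bar>" for k z using tf[of k z] by linarith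
    then show "AE z in F. norm \<bar>f z - t k z\<bar> \<le> 2 * \<bar>f z\<bar>" for k by simp
  qed (use int in auto)
  then have "(\<lambda>k. \<integral>z. \<bar>f z - t k z\<bar> \<partial>F) \<longlonglongrightarrow> 0" by simp
  then have "\<forall>\<^sub>F k in sequentially. (\<integral>z. \<bar>f z - t k z\<bar> \<partial>F) < \<epsilon> / 8"
    by (rule order_tendstoD) (use \<open>\<epsilon> > 0\<close> in auto)
  then obtain k where k: "(\<integral>z. \<bar>f z - t k z\<bar> \<partial>F) < \<epsilon> / 8"
    by (auto dest: eventually_happens)
  define r where "r z = f z - t k z" for z
  have ri: "integrable F r" unfolding r_def using int ti by auto
  have "(\<lambda>n. \<epsilon> / 4 + (2 * real k)\<^sup>2 / (\<epsilon> / 4) / real n) \<longlonglongrightarrow> \<epsilon> / 4 + 0"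
    by (intro tendsto_add tendsto_const lim_const_over_n)
  then have "\<forall>\<^sub>F n in sequentially. \<epsilon> / 4 + (2 * real k)\<^sup>2 / (\<epsilon> / 4) / real n < \<epsilon> / 2"
    by (rule order_tendstoD) (use \<open>\<epsilon> > 0\<close> in auto)
  then obtain N where N: "\<And>n. n \<ge> N \<Longrightarrow> \<epsilon> / 4 + (2 * real k)\<^sup>2 / (\<epsilon> / 4) / real n < \<epsilon> / 2"
    unfolding eventually_sequentially by blast
  have "expectation (\<lambda>\<omega>. \<bar>mean f n \<omega> - (\<integral>z. f z \<partial>F)\<bar>) < \<epsilon>" if n: "n \<ge> max N 1" for n
  proof -
    have "n > 0" using n by simp
    have "(\<integral>z. f z \<partial>F) = (\<integral>z. t k z \<partial>F) + (\<integral>z. r z \<partial>F)"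
      unfolding r_def using int ti by simp
    moreover have "\<bar>\<integral>z. r z \<partial>F\<bar> \<le> (\<integral>z. \<bar>r z\<bar> \<partial>F)" by (rule integral_abs_bound)
    moreover have "mean f n \<omega> = mean (t k) n \<omega> + mean r n \<omega>" for \<omega>
      by (simp add: mean_def r_def sum_subtractf add_divide_distrib[symmetric])
    moreover have "\<bar>mean r n \<omega>\<bar> \<le> mean (\<lambda>z. \<bar>r z\<bar>) n \<omega>" for \<omega>
      by (simp add: mean_def divide_right_mono)
    ultimately have le: "\<bar>mean f n \<omega> - (\<integral>z. f z \<partial>F)\<bar>
        \<le> \<bar>mean (t k) n \<omega> - (\<integral>z. t k z \<partial>F)\<bar> + mean (\<lambda>z. \<bar>r z\<bar>) n \<omega> + (\<integral>z. \<bar>r z\<bar> \<partial>F)" for \<omega>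
      by (smt (verit))
    have i1: "integrable M (\<lambda>\<omega>. \<bar>mean (t k) n \<omega> - (\<integral>z. t k z \<partial>F)\<bar>)"
      using integrable_mean[OF ti] by auto
    have i2: "integrable M (mean (\<lambda>z. \<bar>r z\<bar>) n)"
      using ri by (intro integrable_mean) auto
    have "expectation (\<lambda>\<omega>. \<bar>mean f n \<omega> - (\<integral>z. f z \<partial>F)\<bar>)
      \<le> expectation (\<lambda>\<omega>. \<bar>mean (t k) n \<omega> - (\<integral>z. t k z \<partial>F)\<bar> + mean (\<lambda>z. \<bar>r z\<bar>) n \<omega> + (\<integral>z. \<bar>r z\<bar> \<partial>F))"
      using le i1 i2 integrable_mean[OF int] by (intro integral_mono) auto
    also have "\<dots> = expectation (\<lambda>\<omega>. \<bar>mean (t k) n \<omega> - (\<integral>z. t k z \<partial>F)\<bar>) + 2 * (\<integral>z. \<bar>r z\<bar> \<partial>F)"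
      using i1 i2 expectation_mean[of "\<lambda>z. \<bar>r z\<bar>" n] ri \<open>n > 0\<close> by (simp add: prob_space)
    \<comment> \<open>The bounded part uses less than half of \<open>\<epsilon>\<close>. The
      remainder is paid for twice, once in the sample mean and once in the integral.\<close>
    also have "\<dots> < \<epsilon> / 2 + 2 * (\<epsilon> / 8)"
      using expectation_abs_mean_bounded[of "t k" "real k" "\<epsilon> / 4" n] tb N[of n] n k \<open>\<epsilon> > 0\<close>
      unfolding r_def by fastforce
    finally show ?thesis using \<open>\<epsilon> > 0\<close> by simp
  qed
  then have "norm (expectation (\<lambda>\<omega>. \<bar>mean f n \<omega> - (\<integral>z. f z \<partial>F)\<bar>) - 0) < \<epsilon>"
    if "n \<ge> max N 1" for n
    using that unfolding diff_0_right real_norm_def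
    by (subst abs_of_nonneg) (auto intro!: Bochner_Integration.integral_nonneg)
  then show "\<exists>N. \<forall>n\<ge>N. norm (expectation (\<lambda>\<omega>. \<bar>mean f n \<omega> - (\<integral>z. f z \<partial>F)\<bar>) - 0) < \<epsilon>"
    by (intro exI[of _ "max N 1"] allI impI)
qed

lemma weak_law_of_large_numbers:
  assumes "integrable F f" "\<epsilon> > 0"
  shows "whp (\<lambda>n \<omega>. \<bar>mean f n \<omega> - (\<integral>z. f z \<partial>F)\<bar> \<le> \<epsilon>)"
proof (rule whp_Markov)
  show "integrable M (\<lambda>\<omega>. \<bar>mean f n \<omega> - (\<integral>z. f z \<partial>F)\<bar>)" for n
    by (intro integrable_abs Bochner_Integration.integrable_diff integrable_mean assms integrable_const)
  show "(\<lambda>n. expectation (\<lambda>\<omega>. \<bar>mean f n \<omega> - (\<integral>z. f z \<partial>F)\<bar>)) \<longlonglongrightarrow> 0"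
    by (rule mean_tendsto_L1[OF assms(1)])
  show "0 < \<epsilon>" by (rule assms)
qed (rule abs_ge_zero)

lemma whp_mean_less:
  assumes "integrable F f" "(\<integral>z. f z \<partial>F) < c"
  shows "whp (\<lambda>n \<omega>. mean f n \<omega> < c)"
proof -
  have "whp (\<lambda>n \<omega>. \<bar>mean f n \<omega> - (\<integral>z. f z \<partial>F)\<bar> \<le> (c - (\<integral>z. f z \<partial>F)) / 2)"
    using assms by (intro weak_law_of_large_numbers) auto
  moreover have "mean f n \<omega> < c" if "\<bar>mean f n \<omega> - (\<integral>z. f z \<partial>F)\<bar> \<le> (c - (\<integral>z. f z \<partial>F)) / 2" for n \<omega>
    using abs_le_D1[OF that] assms(2) by (simp add: field_simps)
  ultimately show ?thesis
    by (rule whp_mono)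
qed

end

subsection \<open>Uniform local bounds with small mean\<close>

text \<open>\<open>Y\<close> is approximated by random points of a countable dense subset of
  \<open>T\<close>. For such points measurability can be checked one value at a time, and continuity
  in the parameter carries it to the limit.\<close>

lemma borel_measurable_Caratheodory:
  fixes g :: "'z \<Rightarrow> 'b::euclidean_space \<Rightarrow> real"
  assumes meas: "\<And>t. t \<in> T \<Longrightarrow> (\<lambda>z. g z t) \<in> borel_measurable N"
    and cont: "\<And>z. continuous_on T (g z)"
    and X [measurable]: "X \<in> M \<rightarrow>\<^sub>M N" and Y: "Y \<in> M \<rightarrow>\<^sub>M restrict_space borel T"
  shows "(\<lambda>\<omega>. g (X \<omega>) (Y \<omega>)) \<in> borel_measurable M"
proof (cases "T = {}")
  case True
  then have "space M = {}"
    using measurable_space[OF Y] by (auto simp: space_restrict_space)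
  then show ?thesis by (simp add: measurable_def)
next
  case False
  obtain D where D: "countable D" "D \<subseteq> T" "T \<subseteq> closure D"
    using separable by blast
  with False have "D \<noteq> {}" by auto
  define d where "d = from_nat_into D"
  have d: "d n \<in> T" for n
    unfolding d_def by (rule subsetD[OF D(2) from_nat_into[OF \<open>D \<noteq> {}\<close>]])
  have dense: "\<exists>n. dist (d n) y < e" if "y \<in> T" "e > 0" for y e
  proof -
    have "y \<in> closure D" using D(3) \<open>y \<in> T\<close> by (rule subsetD)
    then obtain x where "x \<in> D" "dist x y < e"
      using \<open>e > 0\<close> unfolding closure_approachable by blast
    moreover obtain n where "d n = x"
      using from_nat_into_surj[OF D(1) \<open>x \<in> D\<close>] unfolding d_def by blast
    ultimately show ?thesis by blast
  qed
  have [measurable]: "Y \<in> borel_measurable M"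
    using Y by (rule measurable_restrict_space2_iff[THEN iffD1, THEN conjunct1])
  have YT: "Y \<omega> \<in> T" if "\<omega> \<in> space M" for \<omega>
    using measurable_space[OF Y that] by (simp add: space_restrict_space)
  \<comment> \<open>Choosing the first dense point within \<open>1 / Suc k\<close> of
    \<open>Y \<omega>\<close> makes the selection measurable.\<close>
  define i where "i k \<omega> = (LEAST n. dist (d n) (Y \<omega>) < 1 / Suc k)" for k \<omega>
  have [measurable]: "i k \<in> M \<rightarrow>\<^sub>M count_space UNIV" for k
    unfolding i_def by measurable
  have [measurable]: "(\<lambda>\<omega>. g (X \<omega>) (d n)) \<in> borel_measurable M" for n
    using meas[OF d] X by (rule measurable_compose[rotated])
  show ?thesis
  proof (rule borel_measurable_LIMSEQ_real)
    show "(\<lambda>\<omega>. g (X \<omega>) (d (i k \<omega>))) \<in> borel_measurable M" for k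
      by (rule measurable_compose_countable[where f = "\<lambda>n \<omega>. g (X \<omega>) (d n)"]) measurable
    fix \<omega> assume "\<omega> \<in> space M"
    then have T: "Y \<omega> \<in> T" by (rule YT)
    have "dist (d (i k \<omega>)) (Y \<omega>) < 1 / Suc k" for k
      unfolding i_def by (rule LeastI_ex) (rule dense, use T in auto)
    then have "\<forall>\<^sub>F k in sequentially. norm (dist (d (i k \<omega>)) (Y \<omega>)) \<le> 1 / real (Suc k)"
      by (intro always_eventually allI) (simp only: real_norm_def abs_of_nonneg[OF zero_le_dist] less_imp_le)
    then have "(\<lambda>k. dist (d (i k \<omega>)) (Y \<omega>)) \<longlonglongrightarrow> 0"
      by (rule Lim_null_comparison) (rule LIMSEQ_Suc[OF lim_1_over_n])
    then have "(\<lambda>k. d (i k \<omega>)) \<longlonglongrightarrow> Y \<omega>"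
      by (rule tendsto_dist_iff[THEN iffD2])
    then show "(\<lambda>k. g (X \<omega>) (d (i k \<omega>))) \<longlonglongrightarrow> g (X \<omega>) (Y \<omega>)"
      by (rule continuous_on_tendsto_compose[OF cont]) (simp_all add: T d)
  qed
qed

text \<open>The supremum of \<open>\<bar>h z t\<bar>\<close> over shrinking neighbourhoods of
  \<open>c\<close> tends to 0 for each \<open>z\<close> and is dominated by \<open>m\<close>, so its
  integral becomes small. The point \<open>c\<close> may lie outside \<open>T\<close>, as happens
  when \<open>T\<close> is the complement of a diagonal.\<close>

lemma uniform_local_bound:
  fixes h :: "'z \<Rightarrow> 'b::euclidean_space \<Rightarrow> real"
  assumes meas: "\<And>t. t \<in> T \<Longrightarrow> (\<lambda>z. h z t) \<in> borel_measurable F"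
    and cont: "\<And>z. continuous_on T (h z)"
    and bound: "\<And>z t. t \<in> T \<Longrightarrow> \<bar>h z t\<bar> \<le> m z"
    and int: "integrable F m"
    and small: "\<And>z e. e > 0 \<Longrightarrow> \<exists>r>0. \<forall>t\<in>T \<inter> ball c r. \<bar>h z t\<bar> \<le> e"
    and "\<epsilon> > 0"
  shows "\<exists>r>0. \<exists>w. integrable F w \<and> (\<forall>z. 0 \<le> w z) \<and> (\<integral>z. w z \<partial>F) < \<epsilon> \<and>
           (\<forall>z. \<forall>t\<in>T \<inter> ball c r. \<bar>h z t\<bar> \<le> w z)"
proof (cases "\<exists>r>0. T \<inter> ball c r = {}")
  \<comment> \<open>If some ball around \<open>c\<close> misses \<open>T\<close>, the zero function
    serves as envelope.\<close>
  case True
  then show ?thesis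
    using \<open>\<epsilon> > 0\<close> by (auto intro!: exI[of _ "\<lambda>_. 0"])
next
  case False
  define S where "S k = T \<inter> ball c (1 / Suc k)" for k
  \<comment> \<open>A countable dense subset keeps the supremum measurable; continuity of
    \<open>h z\<close> later extends the bound from \<open>D k\<close> to all of
    \<open>S k\<close>.\<close>
  have "\<exists>D. countable D \<and> D \<subseteq> S k \<and> S k \<subseteq> closure D" for k
    using separable by metis
  then obtain D where D: "\<And>k. countable (D k)" "\<And>k. D k \<subseteq> S k" "\<And>k. S k \<subseteq> closure (D k)"
    by metis
  have "S k \<noteq> {}" for k
    using False unfolding S_def by (metis of_nat_0_less_iff zero_less_Suc zero_less_divide_1_iff)
  with D(3) have Dne: "D k \<noteq> {}" for k by (metis closure_empty subset_empty)
  have DT: "t \<in> T" if "t \<in> D k" for t k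
    using D(2) that unfolding S_def by blast
  define w where "w k z = (SUP t\<in>D k. \<bar>h z t\<bar>)" for k z
  have bdd: "bdd_above ((\<lambda>t. \<bar>h z t\<bar>) ` D k)" for k z
    by (rule bdd_aboveI2[where M = "m z"]) (use bound DT in blast)
  have wD: "\<bar>h z t\<bar> \<le> w k z" if "t \<in> D k" for k z t
    unfolding w_def by (rule cSUP_upper[OF that bdd])
  have w0: "0 \<le> w k z" for k z
    using wD Dne[of k] by (metis abs_ge_zero all_not_in_conv order_trans)
  have wm: "w k z \<le> m z" for k z
    unfolding w_def by (rule cSUP_least[OF Dne]) (use bound DT in blast)
  have [measurable]: "w k \<in> borel_measurable F" for k
    unfolding w_def by (rule borel_measurable_cSUP[OF D(1) _ bdd]) (use meas DT in auto)
  have wS: "\<bar>h z t\<bar> \<le> w k z" if t: "t \<in> S k" for k z t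
  proof -
    obtain x where x: "\<And>n. x n \<in> D k" "x \<longlonglongrightarrow> t"
      using subsetD[OF D(3) t] unfolding closure_sequential by blast
    have "(\<lambda>n. h z (x n)) \<longlonglongrightarrow> h z t"
      by (rule continuous_on_tendsto_compose[OF cont x(2)]) (use t DT[OF x(1)] in \<open>simp_all add: S_def\<close>)
    then have "(\<lambda>n. \<bar>h z (x n)\<bar>) \<longlonglongrightarrow> \<bar>h z t\<bar>"
      by (rule tendsto_rabs)
    then show ?thesis
      by (rule LIMSEQ_le_const2) (use wD[OF x(1)] in simp)
  qed
  have "(\<lambda>k. \<integral>z. w k z \<partial>F) \<longlonglongrightarrow> (\<integral>z. 0 \<partial>F)"
  proof (rule integral_dominated_convergence[OF _ _ int])
    have "(\<lambda>k. w k z) \<longlonglongrightarrow> 0" for z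
    proof (rule LIMSEQ_I)
      fix e :: real assume "e > 0"
      then obtain r where r: "r > 0" "\<And>t. t \<in> T \<inter> ball c r \<Longrightarrow> \<bar>h z t\<bar> \<le> e / 2"
        using small[of "e / 2" z] by auto
      obtain N where N: "1 / Suc N < r"
        using nat_approx_posE[OF r(1)] by blast
      have "w k z < e" if "k \<ge> N" for k
      proof -
        have "1 / real (Suc k) \<le> 1 / Suc N" using that by (intro divide_left_mono) auto
        then have "D k \<subseteq> T \<inter> ball c r" using D(2)[of k] N unfolding S_def by auto
        then have "w k z \<le> e / 2" unfolding w_def by (intro cSUP_least[OF Dne] r(2)) auto
        then show ?thesis using \<open>e > 0\<close> by simp
      qed
      then show "\<exists>N. \<forall>k\<ge>N. norm (w k z - 0) < e" using w0 by (auto intro!: exI[of _ N])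
    qed
    then show "AE z in F. (\<lambda>k. w k z) \<longlonglongrightarrow> 0" by simp
  qed (use w0 wm in auto)
  then have "(\<lambda>k. \<integral>z. w k z \<partial>F) \<longlonglongrightarrow> 0" by simp
  then have "\<forall>\<^sub>F k in sequentially. (\<integral>z. w k z \<partial>F) < \<epsilon>"
    by (rule order_tendstoD) (use \<open>\<epsilon> > 0\<close> in auto)
  then obtain k where k: "(\<integral>z. w k z \<partial>F) < \<epsilon>"
    by (auto dest: eventually_happens)
  have wi: "integrable F (w k)"
    by (rule Bochner_Integration.integrable_bound[OF int]) (use w0 wm in \<open>auto simp: order_trans[OF _ abs_ge_self]\<close>)
  show ?thesis
    using k w0 wS[of _ k] wi unfolding S_def
    by (intro exI[of _ "1 / Suc k"] conjI exI[of _ "w k"]) auto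
qed

section \<open>Gradients: measurability and strict differentiability\<close>

lemma gradient_difference_quotient_tendsto:
  fixes f :: "'b::euclidean_space \<Rightarrow> real"
  assumes deriv: "(f has_derivative (\<lambda>h. G \<bullet> h)) (at x)" and s: "s \<longlonglongrightarrow> (0::real)" "\<And>n. s n \<noteq> 0"
  shows "(\<lambda>n. (f (x + s n *\<^sub>R v) - f x) / s n) \<longlonglongrightarrow> G \<bullet> v"
proof -
  have "((\<lambda>t. f (x + t *\<^sub>R v)) has_derivative (\<lambda>t. G \<bullet> (t *\<^sub>R v))) (at 0)"
    by (rule has_derivative_compose[where g = f and f = "\<lambda>t. x + t *\<^sub>R v"])
      (auto intro!: derivative_eq_intros simp: deriv)
  then have "((\<lambda>t. f (x + t *\<^sub>R v)) has_field_derivative (G \<bullet> v)) (at 0)"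
    by (simp add: has_field_derivative_def mult.commute[of _ "G \<bullet> v"])
  then have "(\<lambda>t. (f (x + t *\<^sub>R v) - f x) / t) \<midarrow>0\<rightarrow> G \<bullet> v"
    by (simp add: DERIV_def)
  then show ?thesis
    by (rule filterlim_compose) (use s in \<open>auto intro!: filterlim_atI\<close>)
qed


text \<open>Each coordinate of the gradient is a pointwise limit of difference quotients, taken at
  points of \<open>S\<close>, where \<open>g\<close> is measurable in \<open>z\<close>.\<close>

lemma borel_measurable_gradient:
  fixes g :: "'z \<Rightarrow> 'b::euclidean_space \<Rightarrow> real"
  assumes x: "x \<in> interior S" and meas: "\<And>t. t \<in> S \<Longrightarrow> (\<lambda>z. g z t) \<in> borel_measurable F"
    and deriv: "\<And>z. (g z has_derivative (\<lambda>h. G z \<bullet> h)) (at x)"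
  shows "G \<in> borel_measurable F"
proof (subst borel_measurable_euclidean_space, intro ballI)
  fix v :: 'b assume v: "v \<in> Basis"
  obtain e where e: "e > 0" "ball x e \<subseteq> S"
    using x unfolding mem_interior by blast
  \<comment> \<open>The factor 1/2 keeps even the first step strictly shorter than
    \<open>e\<close>.\<close>
  define s where "s n = e / 2 / Suc n" for n
  have s0: "s \<longlonglongrightarrow> 0"
    unfolding s_def by (rule LIMSEQ_Suc[OF lim_const_over_n])
  have sn: "0 < s n" "s n < e" for n
    using e(1) by (auto simp: s_def field_simps intro!: add_pos_nonneg)
  have S: "x + s n *\<^sub>R v \<in> S" for n
    using sn[of n] e(2) v by (intro subsetD[OF e(2)]) (simp add: dist_norm)
  have "x \<in> S" using x interior_subset by blast
  show "(\<lambda>z. G z \<bullet> v) \<in> borel_measurable F"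
  proof (rule borel_measurable_LIMSEQ_real)
    show "(\<lambda>n. (g z (x + s n *\<^sub>R v) - g z x) / s n) \<longlonglongrightarrow> G z \<bullet> v" for z
      by (rule gradient_difference_quotient_tendsto[OF deriv s0]) (use sn in \<open>simp add: less_imp_neq[symmetric]\<close>)
    show "(\<lambda>z. (g z (x + s n *\<^sub>R v) - g z x) / s n) \<in> borel_measurable F" for n
      using meas[OF S[of n]] meas[OF \<open>x \<in> S\<close>] by measurable
  qed
qed

text \<open>This is the mean value inequality for \<open>f\<close> minus the linear map with
  gradient \<open>G c\<close>. The error involves only the oscillation of \<open>G\<close> about
  \<open>c\<close>, although neither \<open>x\<close> nor \<open>y\<close> has to be
  \<open>c\<close>.\<close>

lemma gradient_linearisation_bound:
  fixes f :: "'b::euclidean_space \<Rightarrow> real"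
  assumes deriv: "\<And>t. t \<in> S \<Longrightarrow> (f has_derivative (\<lambda>h. G t \<bullet> h)) (at t within S)"
    and "convex S" and B: "\<And>t. t \<in> S \<Longrightarrow> norm (G t - G c) \<le> B"
    and "c \<in> S" "x \<in> S" "y \<in> S"
  shows "\<bar>f x - f y - G c \<bullet> (x - y)\<bar> \<le> B * norm (x - y)"
proof -
  have "norm (f x - f y - G c \<bullet> (x - y)) \<le> norm (x - y) * B"
  proof (rule differentiable_bound_linearization[where f' = "\<lambda>t h. G t \<bullet> h"])
    show "y + t *\<^sub>R (x - y) \<in> S" if "t \<in> {0..1}" for t
      using \<open>convex S\<close> \<open>x \<in> S\<close> \<open>y \<in> S\<close> that
      by (auto simp: convex_alt algebra_simps)
    show "onorm ((\<bullet>) (G t) - (\<bullet>) (G c)) \<le> B" if "t \<in> S" for t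
    proof (rule onorm_le)
      show "norm (((\<bullet>) (G t) - (\<bullet>) (G c)) h) \<le> B * norm h" for h
        using Cauchy_Schwarz_ineq2[of "G t - G c" h] mult_right_mono[OF B[OF that] norm_ge_zero[of h]]
        by (simp add: inner_diff_left)
    qed
  qed (use deriv \<open>c \<in> S\<close> in auto)
  then show ?thesis by (simp add: mult.commute)
qed

text \<open>The weighted remainder divided by \<open>norm (x - y)\<close> is a function of the pair
  of points to which \<open>uniform_local_bound\<close> applies at \<open>(c, c)\<close>: it is
  dominated by \<open>2 * (m z * L z)\<close> and small near \<open>(c, c)\<close> because
  \<open>G z\<close> is continuous at \<open>c\<close>. The weight \<open>m\<close> allows the
  remainder to be paired with a second envelope.\<close>

lemma uniform_strict_differentiability:
  fixes g :: "'z \<Rightarrow> 'b::euclidean_space \<Rightarrow> real"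
  assumes c: "c \<in> interior \<Theta>"
    and meas: "\<And>t. t \<in> \<Theta> \<Longrightarrow> (\<lambda>z. g z t) \<in> borel_measurable F"
    and deriv: "\<And>z t. t \<in> \<Theta> \<Longrightarrow> (g z has_derivative (\<lambda>h. G z t \<bullet> h)) (at t within \<Theta>)"
    and cont: "\<And>z. isCont (G z) c"
    and bound: "\<And>z t. t \<in> \<Theta> \<Longrightarrow> norm (G z t) \<le> L z"
    and m: "\<And>z. 0 \<le> m z" "m \<in> borel_measurable F"
    and int: "integrable F (\<lambda>z. m z * L z)"
    and "\<epsilon> > 0"
  shows "\<exists>r>0. \<exists>w. integrable F w \<and> (\<forall>z. 0 \<le> w z) \<and> (\<integral>z. w z \<partial>F) < \<epsilon> \<and>
           (\<forall>z. \<forall>x\<in>ball c r. \<forall>y\<in>ball c r.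
              m z * \<bar>g z x - g z y - G z c \<bullet> (x - y)\<bar> \<le> w z * norm (x - y))"
proof -
  obtain e where e: "e > 0" "ball c e \<subseteq> \<Theta>"
    using c unfolding mem_interior by blast
  have ball_deriv: "(g z has_derivative (\<lambda>h. G z t \<bullet> h)) (at t within ball c r)"
    if "t \<in> ball c r" "r \<le> e" for z t r
    using that e(2) by (intro has_derivative_subset[OF deriv]) (auto simp: subset_eq)
  \<comment> \<open>The remainder quotient is continuous off the diagonal, unlike \<open>G z\<close> away from \<open>c\<close>.\<close>
  define T where "T = {p \<in> ball c e \<times> ball c e. fst p \<noteq> snd p}"
  define h where "h z p = m z * (g z (fst p) - g z (snd p) - G z c \<bullet> (fst p - snd p)) / norm (fst p - snd p)"
    for z p
  \<comment> \<open>This serves twice: with \<open>B = 2 * L z\<close> on the whole ball it gives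
    the domination, and with a small \<open>B\<close> near \<open>c\<close> it gives the smallness
    at \<open>(c, c)\<close>.\<close>
  have key: "\<bar>h z p\<bar> \<le> m z * B"
    if p: "p \<in> T" "fst p \<in> ball c r" "snd p \<in> ball c r" and r: "r \<le> e" 
      and B: "\<And>t. t \<in> ball c r \<Longrightarrow> norm (G z t - G z c) \<le> B" for z p r B
  proof -
    have "\<bar>g z (fst p) - g z (snd p) - G z c \<bullet> (fst p - snd p)\<bar> \<le> B * norm (fst p - snd p)"
      by (rule gradient_linearisation_bound[where S = "ball c r"])
        (use p(2,3) r B ball_deriv in \<open>auto simp: le_less_trans[OF zero_le_dist]\<close>)
    then have "m z * \<bar>g z (fst p) - g z (snd p) - G z c \<bullet> (fst p - snd p)\<bar> \<le> m z * (B * norm (fst p - snd p))"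
      by (rule mult_left_mono) (rule m)
    moreover have "0 < norm (fst p - snd p)" using p(1) by (auto simp: T_def)
    ultimately show ?thesis
      using m(1)[of z] by (simp add: h_def abs_mult pos_divide_le_eq mult.assoc)
  qed
  have bound': "norm (G z t - G z c) \<le> 2 * L z" if "t \<in> ball c e" for z t
  proof -
    have "t \<in> \<Theta>" "c \<in> \<Theta>" using that e centre_in_ball[of c e] by blast+
    then show ?thesis
      using norm_triangle_ineq4[of "G z t" "G z c"] bound[of t z] bound[of c z] by linarith
  qed
  have Gmeas: "(\<lambda>z. G z c) \<in> borel_measurable F"
    by (rule borel_measurable_gradient[OF c meas])
      (use deriv[OF subsetD[OF interior_subset c]] in \<open>simp_all add: at_within_interior[OF c]\<close>)
  have "\<exists>r>0. \<exists>w. integrable F w \<and> (\<forall>z. 0 \<le> w z) \<and> (\<integral>z. w z \<partial>F) < \<epsilon> \<and>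
           (\<forall>z. \<forall>p\<in>T \<inter> ball (c, c) r. \<bar>h z p\<bar> \<le> w z)"
  proof (rule uniform_local_bound)
    show "integrable F (\<lambda>z. 2 * (m z * L z))" using int by simp
    show "\<bar>h z p\<bar> \<le> 2 * (m z * L z)" if "p \<in> T" for z p
      using key[of p e z "2 * L z"] bound' that by (auto simp: T_def)
    show "(\<lambda>z. h z p) \<in> borel_measurable F" if "p \<in> T" for p
    proof -
      have "fst p \<in> \<Theta>" "snd p \<in> \<Theta>" using that e(2) by (auto simp: T_def)
      from meas[OF this(1)] meas[OF this(2)] m(2) Gmeas show ?thesis
        unfolding h_def by measurable
    qed
    show "continuous_on T (h z)" for z
    proof -
      have g: "continuous_on (ball c e) (g z)"
        using ball_deriv[of _ e z] by (intro has_derivative_continuous_on) auto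
      have "continuous_on T (\<lambda>p. g z (fst p))" "continuous_on T (\<lambda>p. g z (snd p))"
        by (rule continuous_on_compose2[OF g]; auto intro!: continuous_intros simp: T_def)+
      then show ?thesis
        unfolding h_def by (intro continuous_intros) (auto simp: T_def)
    qed
    fix z and d :: real assume "d > 0"
    \<comment> \<open>The added 1 avoids division by 0 when \<open>m z\<close> vanishes and still
      leaves \<open>m z * d' \<le> d\<close>.\<close>
    define d' where "d' = d / (m z + 1)"
    have "d' > 0" using \<open>d > 0\<close> m(1)[of z] by (simp add: d'_def)
    then obtain r where r: "r > 0" "\<And>t. dist t c < r \<Longrightarrow> norm (G z t - G z c) < d'"
      using cont[of z] unfolding continuous_at_eps_delta dist_norm by blast
    have "\<bar>h z p\<bar> \<le> d" if p: "p \<in> T \<inter> ball (c, c) (min r e)" for p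
    proof -
      have "\<bar>h z p\<bar> \<le> m z * d'"
      proof (rule key[of p "min r e"])
        show "fst p \<in> ball c (min r e)" "snd p \<in> ball c (min r e)"
          using p dist_fst_le[of "(c, c)" p] dist_snd_le[of "(c, c)" p] by auto
        show "norm (G z t - G z c) \<le> d'" if "t \<in> ball c (min r e)" for t
          using r(2)[of t] that by (simp add: dist_commute)
      qed (use p in auto)
      also have "\<dots> \<le> d" using m(1)[of z] \<open>d > 0\<close> by (simp add: d'_def field_simps)
      finally show ?thesis .
    qed
    then show "\<exists>r>0. \<forall>p\<in>T \<inter> ball (c, c) r. \<bar>h z p\<bar> \<le> d"
      using r(1) e(1) by (intro exI[of _ "min r e"]) auto
  qed (rule \<open>\<epsilon> > 0\<close>)
  then obtain r w where r: "r > 0" and w: "integrable F w" "\<And>z. 0 \<le> w z" "(\<integral>z. w z \<partial>F) < \<epsilon>"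
    "\<And>z p. p \<in> T \<inter> ball (c, c) r \<Longrightarrow> \<bar>h z p\<bar> \<le> w z"
    by blast
  \<comment> \<open>The radius is halved since the distance of \<open>(x, y)\<close> from
    \<open>(c, c)\<close> is at most the sum of the two coordinate distances.\<close>
  have "m z * \<bar>g z x - g z y - G z c \<bullet> (x - y)\<bar> \<le> w z * norm (x - y)"
    if xy: "x \<in> ball c (min (r / 2) e)" "y \<in> ball c (min (r / 2) e)" for z x y
  proof (cases "x = y")
    case False
    have "dist (c, c) (x, y) \<le> dist c x + dist c y"
      unfolding dist_Pair_Pair by (rule sqrt_sum_squares_le_sum) auto
    then have "(x, y) \<in> T \<inter> ball (c, c) r"
      using xy False by (auto simp: T_def)
    from w(4)[OF this, of z] False show ?thesis
      using m(1)[of z] by (simp add: h_def abs_mult pos_divide_le_eq)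
  qed simp
  then show ?thesis
    using r e(1) w by (intro exI[of _ "min (r / 2) e"] conjI exI[of _ w]) auto
qed

subsection \<open>Vectors and matrices\<close>

lemma measurable_vec_nth [measurable (raw)]:
  fixes f :: "'a \<Rightarrow> real^'n"
  assumes "f \<in> borel_measurable M"
  shows "(\<lambda>x. f x $ k) \<in> borel_measurable M"
  by (rule borel_measurable_continuous_on[OF _ assms]) (intro continuous_intros)

lemma integrable_vec_nth:
  fixes f :: "'a \<Rightarrow> real^'n"
  assumes "integrable M f"
  shows "integrable M (\<lambda>x. f x $ k)"
  by (rule integrable_bounded_linear[OF bounded_linear_vec_nth assms])

lemma integral_vec_nth:
  fixes f :: "'a \<Rightarrow> real^'n"
  assumes "integrable M f"
  shows "(\<integral>x. f x $ k \<partial>M) = (\<integral>x. f x \<partial>M) $ k"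
  by (rule integral_bounded_linear[OF bounded_linear_vec_nth assms])

lemma norm_le_CARD_mult:
  fixes x :: "real^'n"
  assumes "\<And>i. \<bar>x $ i\<bar> \<le> B"
  shows "norm x \<le> real CARD('n) * B"
  by (rule order_trans[OF norm_le_l1_cart]) (use sum_bounded_above[of UNIV "\<lambda>i. \<bar>x $ i\<bar>" B] assms in simp)

text \<open>The product is dominated by the sum of the squares. With one factor constantly 1, on a
  probability space, this also derives integrability from square integrability.\<close>

lemma integrable_mult_of_squares:
  fixes f g :: "'a \<Rightarrow> real"
  assumes [measurable]: "f \<in> borel_measurable M" "g \<in> borel_measurable M"
    and "integrable M (\<lambda>x. (f x)\<^sup>2)" "integrable M (\<lambda>x. (g x)\<^sup>2)"
  shows "integrable M (\<lambda>x. f x * g x)"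
proof (rule Bochner_Integration.integrable_bound)
  show "integrable M (\<lambda>x. (f x)\<^sup>2 + (g x)\<^sup>2)"
    using assms by simp
  have "\<bar>a * b\<bar> \<le> a\<^sup>2 + b\<^sup>2" for a b :: real
  proof -
    have "0 \<le> (\<bar>a\<bar> - \<bar>b\<bar>)\<^sup>2" by simp
    then have "2 * \<bar>a * b\<bar> \<le> a\<^sup>2 + b\<^sup>2" by (simp add: power2_diff abs_mult)
    then show ?thesis using abs_ge_zero[of "a * b"] by linarith
  qed
  then show "AE x in M. norm (f x * g x) \<le> norm ((f x)\<^sup>2 + (g x)\<^sup>2)" by simp
qed measurable

text \<open>Applying \<open>B\<close> to the approximate equation isolates
  \<open>N *\<^sub>R a\<close> with an error of at most \<open>K * e\<close> times its own norm. As
  \<open>K * e \<le> 1 / 2\<close>, the error is absorbed, which bounds \<open>a\<close> in terms of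
  \<open>v\<close>; inserting that bound into the error gives the second claim.\<close>

lemma solve_perturbed_linear:
  fixes J B :: "real^'p^'p"
  assumes BJ: "B ** J = mat 1" and K: "\<And>x. norm (B *v x) \<le> K * norm x" "K \<ge> 0"
    and N: "N > 0" and e: "e \<ge> 0" "K * e \<le> 1 / 2"
    and le: "norm (v + N *\<^sub>R (J *v a)) \<le> N * e * norm a"
  shows "N * norm a \<le> 2 * K * norm v" and "norm (B *v v + N *\<^sub>R a) \<le> 2 * K\<^sup>2 * e * norm v"
proof -
  have eq: "B *v (v + N *\<^sub>R (J *v a)) = B *v v + N *\<^sub>R a"
    by (simp add: matrix_vector_right_distrib matrix_vector_mult_scaleR matrix_vector_mul_assoc BJ)
  have 1: "norm (B *v v + N *\<^sub>R a) \<le> K * e * (N * norm a)"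
    using K(1)[of "v + N *\<^sub>R (J *v a)"] mult_left_mono[OF le K(2)]
    unfolding eq by (simp add: mult_ac)
  also have "\<dots> \<le> 1 / 2 * (N * norm a)"
    using e N by (intro mult_right_mono) auto
  finally have "norm (B *v v + N *\<^sub>R a) \<le> N * norm a / 2" by simp
  moreover have "N * norm a \<le> norm (B *v v + N *\<^sub>R a) + norm (B *v v)"
    using norm_triangle_ineq4[of "B *v v + N *\<^sub>R a" "B *v v"] N by simp
  ultimately show 2: "N * norm a \<le> 2 * K * norm v"
    using K(1)[of v] by linarith
  have "K * e * (N * norm a) \<le> K * e * (2 * K * norm v)"
    using 2 K(2) e(1) by (intro mult_left_mono) auto
  with 1 show "norm (B *v v + N *\<^sub>R a) \<le> 2 * K\<^sup>2 * e * norm v"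
    by (simp add: power2_eq_square mult_ac)
qed

text \<open>This identity turns the bilinear form found in the expansion into the trace of the
  theorem.\<close>

lemma trace_mult_outer_product:
  fixes B :: "real^'p^'p"
  shows "trace (B ** (\<chi> a b. u $ a * v $ b)) = v \<bullet> (B *v u)"
  by (simp add: trace_def matrix_matrix_mult_def matrix_vector_mult_def inner_vec_def
      sum_distrib_left sum_distrib_right mult_ac)

lemma norm_outer_product_le:
  fixes u v :: "real^'p"
  shows "norm (\<chi> a b. u $ a * v $ b) \<le> real CARD('p) * (norm u * norm v)"
proof -
  have "norm (\<chi> a b. u $ a * v $ b) \<le> (\<Sum>a\<in>UNIV. norm ((\<chi> a b. u $ a * v $ b) $ a))"
    unfolding norm_vec_def[of "\<chi> a b. u $ a * v $ b"] by (rule L2_set_le_sum) simp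
  also have "\<dots> \<le> (\<Sum>a\<in>(UNIV :: 'p set). norm u * norm v)"
  proof (rule sum_mono)
    fix a
    have "(\<chi> a b. u $ a * v $ b) $ a = (u $ a) *\<^sub>R v"
      by (simp add: vec_eq_iff)
    then show "norm ((\<chi> a b. u $ a * v $ b) $ a) \<le> norm u * norm v"
      by (simp add: component_le_norm_cart mult_right_mono)
  qed
  finally show ?thesis by simp
qed

text \<open>The map sending \<open>X\<close> to \<open>trace (B ** X)\<close> is bounded and linear,
  hence commutes with the integral of the outer product, whose norm is controlled by the product of
  the norms.\<close>

lemma integral_trace_mult_outer_product:
  fixes f g :: "'a \<Rightarrow> real^'p" and B :: "real^'p^'p"
  assumes [measurable]: "f \<in> borel_measurable M" "g \<in> borel_measurable M"
    and int: "integrable M (\<lambda>x. norm (f x) * norm (g x))"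
  shows "integrable M (\<lambda>x. g x \<bullet> (B *v f x))"
    and "(\<integral>x. g x \<bullet> (B *v f x) \<partial>M) = trace (B ** (\<integral>x. (\<chi> a b. f x $ a * g x $ b) \<partial>M))"
proof -
  have "continuous_on UNIV (\<lambda>x :: (real^'p) \<times> (real^'p). (\<chi> a b. fst x $ a * snd x $ b) :: real^'p^'p)"
    by (intro continuous_intros)
  then have [measurable]: "(\<lambda>x. (\<chi> a b. f x $ a * g x $ b) :: real^'p^'p) \<in> borel_measurable M"
    by (intro borel_measurable_continuous_Pair[where H = "\<lambda>u v. \<chi> a b. u $ a * v $ b"]) simp_all
  have int': "integrable M (\<lambda>x. (\<chi> a b. f x $ a * g x $ b) :: real^'p^'p)"
  proof (rule Bochner_Integration.integrable_bound)
    show "integrable M (\<lambda>x. real CARD('p) * (norm (f x) * norm (g x)))"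
      using int by simp
    show "AE x in M. norm ((\<chi> a b. f x $ a * g x $ b) :: real^'p^'p) \<le> norm (real CARD('p) * (norm (f x) * norm (g x)))"
      by (simp add: norm_outer_product_le)
  qed measurable
  have "linear (\<lambda>X. trace (B ** X))"
    by (rule linearI) (simp_all add: trace_def matrix_matrix_mult_def sum.distrib distrib_left
        sum_distrib_left mult_ac)
  then have bl: "bounded_linear (\<lambda>X. trace (B ** X))"
    by (simp add: linear_conv_bounded_linear)
  show "integrable M (\<lambda>x. g x \<bullet> (B *v f x))"
    using integrable_bounded_linear[OF bl int'] by (simp only: trace_mult_outer_product)
  show "(\<integral>x. g x \<bullet> (B *v f x) \<partial>M) = trace (B ** (\<integral>x. (\<chi> a b. f x $ a * g x $ b) \<partial>M))"
    using integral_bounded_linear[OF bl int'] by (simp only: trace_mult_outer_product)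
qed


subsection \<open>Consistency of the estimators\<close>

text \<open>The matrix \<open>A\<close> is the derivative of the mean score at
  \<open>\<theta>\<^sub>0\<close>, so the matrix J of the theorem is \<open>- A\<close>. Membership
  of the estimators in \<open>\<Theta>\<close> is assumed at every outcome, the estimating equations
  only almost surely and for large \<open>n\<close>.\<close>

locale M_estimation = iid_sample M F Z
  for M :: "'w measure" and F :: "'z measure" and Z :: "nat \<Rightarrow> 'w \<Rightarrow> 'z" +
  fixes \<Theta> :: "(real^'p) set"
    and \<phi> :: "'z \<Rightarrow> real^'p \<Rightarrow> real^'p" and D\<phi> :: "'z \<Rightarrow> real^'p \<Rightarrow> real^'p^'p"
    and A :: "real^'p^'p" and \<theta>\<^sub>0 :: "real^'p" and m\<^sub>0 m\<^sub>1 :: "'z \<Rightarrow> real"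
    and \<theta>hat :: "nat \<Rightarrow> 'w \<Rightarrow> real^'p" and \<theta>loo :: "nat \<Rightarrow> nat \<Rightarrow> 'w \<Rightarrow> real^'p"
  assumes compact: "compact \<Theta>"
    and interior: "\<theta>\<^sub>0 \<in> interior \<Theta>"
    and meas_\<phi>: "\<And>\<theta>. \<theta> \<in> \<Theta> \<Longrightarrow> (\<lambda>z. \<phi> z \<theta>) \<in> borel_measurable F"
    and deriv_\<phi>: "\<And>z \<theta>. \<theta> \<in> \<Theta> \<Longrightarrow> (\<phi> z has_derivative (\<lambda>h. D\<phi> z \<theta> *v h)) (at \<theta> within \<Theta>)"
    and deriv_E\<phi>: "((\<lambda>\<theta>. \<integral>z. \<phi> z \<theta> \<partial>F) has_derivative (\<lambda>h. A *v h)) (at \<theta>\<^sub>0)"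
    and cont_D\<phi>: "\<And>z. isCont (D\<phi> z) \<theta>\<^sub>0"
    and bound_\<phi>: "\<And>z \<theta>. \<theta> \<in> \<Theta> \<Longrightarrow> norm (\<phi> z \<theta>) \<le> m\<^sub>0 z"
    and bound_D\<phi>: "\<And>z \<theta> k. \<theta> \<in> \<Theta> \<Longrightarrow> norm (column k (D\<phi> z \<theta>)) \<le> m\<^sub>1 z"
    and meas_m\<^sub>0: "m\<^sub>0 \<in> borel_measurable F" and square_m\<^sub>0: "integrable F (\<lambda>z. (m\<^sub>0 z)\<^sup>2)"
    and int_m\<^sub>1: "integrable F m\<^sub>1"
    and root: "\<And>\<theta>. \<theta> \<in> \<Theta> \<Longrightarrow> (\<integral>z. \<phi> z \<theta> \<partial>F) = 0 \<longleftrightarrow> \<theta> = \<theta>\<^sub>0"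
    and invertible_A: "invertible A"
    and estimator: "\<And>n \<omega>. n \<ge> 1 \<Longrightarrow> \<omega> \<in> space M \<Longrightarrow> \<theta>hat n \<omega> \<in> \<Theta>"
    and loo_estimator: "\<And>n i \<omega>. i < n \<Longrightarrow> \<omega> \<in> space M \<Longrightarrow> \<theta>loo n i \<omega> \<in> \<Theta>"
    and estimating_eq: "\<forall>\<^sub>F n in sequentially. AE \<omega> in M. (\<Sum>j<n. \<phi> (Z j \<omega>) (\<theta>hat n \<omega>)) = 0"
    and loo_estimating_eq: "\<forall>\<^sub>F n in sequentially. \<forall>i<n. AE \<omega> in M.
          (\<Sum>j\<in>{..<n} - {i}. \<phi> (Z j \<omega>) (\<theta>loo n i \<omega>)) = 0"
begin

lemma \<theta>\<^sub>0_mem: "\<theta>\<^sub>0 \<in> \<Theta>"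
  using interior interior_subset by (rule subsetD[rotated])

lemma m\<^sub>0_nonneg: "0 \<le> m\<^sub>0 z"
  by (rule order_trans[OF norm_ge_zero bound_\<phi>[OF \<theta>\<^sub>0_mem]])

lemma m\<^sub>1_nonneg: "0 \<le> m\<^sub>1 z"
  by (rule order_trans[OF norm_ge_zero bound_D\<phi>[OF \<theta>\<^sub>0_mem]])

lemma int_m\<^sub>0: "integrable F m\<^sub>0"
  using integrable_mult_of_squares[OF meas_m\<^sub>0 _ square_m\<^sub>0, of "\<lambda>_. 1"] by simp

lemma int_\<phi>:
  assumes "\<theta> \<in> \<Theta>"
  shows "integrable F (\<lambda>z. \<phi> z \<theta>)"
  by (rule Bochner_Integration.integrable_bound[OF int_m\<^sub>0 meas_\<phi>[OF assms]])
    (simp add: order_trans[OF bound_\<phi>[OF assms] abs_ge_self])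

lemma continuous_on_\<phi>: "continuous_on \<Theta> (\<phi> z)"
  using deriv_\<phi> by (rule has_derivative_continuous_on)

text \<open>At a leave-one-out estimator the other terms cancel, so the full sum reduces to the
  deleted term. For fixed \<open>n\<close> only finitely many null sets are combined.\<close>

lemma whp_estimating_eqs:
  "whp (\<lambda>n \<omega>. (\<Sum>j<n. \<phi> (Z j \<omega>) (\<theta>hat n \<omega>)) = 0 \<and>
     (\<forall>i<n. (\<Sum>j<n. \<phi> (Z j \<omega>) (\<theta>loo n i \<omega>)) = \<phi> (Z i \<omega>) (\<theta>loo n i \<omega>)))"
proof (rule whp_conj)
  show "whp (\<lambda>n \<omega>. (\<Sum>j<n. \<phi> (Z j \<omega>) (\<theta>hat n \<omega>)) = 0)"
    by (rule whp_eventually_AE[OF estimating_eq])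
  have "whp (\<lambda>n \<omega>. \<forall>i\<in>{..<n}. (\<Sum>j\<in>{..<n} - {i}. \<phi> (Z j \<omega>) (\<theta>loo n i \<omega>)) = 0)"
    by (rule whp_eventually_AE, rule eventually_mono[OF loo_estimating_eq], rule AE_finite_allI) auto
  then show "whp (\<lambda>n \<omega>. \<forall>i<n. (\<Sum>j<n. \<phi> (Z j \<omega>) (\<theta>loo n i \<omega>)) = \<phi> (Z i \<omega>) (\<theta>loo n i \<omega>))"
  proof (rule whp_mono, intro allI impI)
    fix n i :: nat and \<omega>
    assume "\<forall>i\<in>{..<n}. (\<Sum>j\<in>{..<n} - {i}. \<phi> (Z j \<omega>) (\<theta>loo n i \<omega>)) = 0" "i < n"
    then show "(\<Sum>j<n. \<phi> (Z j \<omega>) (\<theta>loo n i \<omega>)) = \<phi> (Z i \<omega>) (\<theta>loo n i \<omega>)"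
      using sum.remove[of "{..<n}" i "\<lambda>j. \<phi> (Z j \<omega>) (\<theta>loo n i \<omega>)"] by simp
  qed
qed

text \<open>Some coordinate of the mean score is nonzero at \<open>\<theta>\<^sub>1\<close>. The law
  of large numbers passes this to the sample score at \<open>\<theta>\<^sub>1\<close>, and an
  oscillation envelope with small mean spreads it over a ball.\<close>

lemma whp_score_bounded_away_local:
  assumes "\<theta>\<^sub>1 \<in> \<Theta>" "\<theta>\<^sub>1 \<noteq> \<theta>\<^sub>0"
  shows "\<exists>r>0. \<exists>c>0. whp (\<lambda>n \<omega>. \<forall>\<theta>\<in>\<Theta> \<inter> ball \<theta>\<^sub>1 r. real n * c < norm (\<Sum>j<n. \<phi> (Z j \<omega>) \<theta>))"
proof -
  have "(\<integral>z. \<phi> z \<theta>\<^sub>1 \<partial>F) \<noteq> 0" using root[OF assms(1)] assms(2) by simp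
  then obtain k where k: "(\<integral>z. \<phi> z \<theta>\<^sub>1 \<partial>F) $ k \<noteq> 0" by (auto simp: vec_eq_iff)
  define c where "c = \<bar>(\<integral>z. \<phi> z \<theta>\<^sub>1 \<partial>F) $ k\<bar>"
  have "c > 0" using k by (simp add: c_def)
  have b: "\<bar>\<phi> z \<theta> $ k\<bar> \<le> m\<^sub>0 z" if "\<theta> \<in> \<Theta>" for z \<theta>
    using component_le_norm_cart bound_\<phi>[OF that] by (rule order_trans)
  have "\<exists>r>0. \<exists>w. integrable F w \<and> (\<forall>z. 0 \<le> w z) \<and> (\<integral>z. w z \<partial>F) < c / 4 \<and>
      (\<forall>z. \<forall>\<theta>\<in>\<Theta> \<inter> ball \<theta>\<^sub>1 r. \<bar>\<phi> z \<theta> $ k - \<phi> z \<theta>\<^sub>1 $ k\<bar> \<le> w z)"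
  proof (rule uniform_local_bound)
    show "(\<lambda>z. \<phi> z \<theta> $ k - \<phi> z \<theta>\<^sub>1 $ k) \<in> borel_measurable F" if "\<theta> \<in> \<Theta>" for \<theta>
      using meas_\<phi>[OF that] meas_\<phi>[OF assms(1)] by measurable
    show "continuous_on \<Theta> (\<lambda>\<theta>. \<phi> z \<theta> $ k - \<phi> z \<theta>\<^sub>1 $ k)" for z
      by (intro continuous_intros continuous_on_\<phi>)
    show "integrable F (\<lambda>z. 2 * m\<^sub>0 z)" using int_m\<^sub>0 by simp
    show "\<bar>\<phi> z \<theta> $ k - \<phi> z \<theta>\<^sub>1 $ k\<bar> \<le> 2 * m\<^sub>0 z" if "\<theta> \<in> \<Theta>" for z \<theta>
      using b[OF that, of z] b[OF assms(1), of z] by linarith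
    show "\<exists>r>0. \<forall>\<theta>\<in>\<Theta> \<inter> ball \<theta>\<^sub>1 r. \<bar>\<phi> z \<theta> $ k - \<phi> z \<theta>\<^sub>1 $ k\<bar> \<le> e" if e: "e > 0" for z e
    proof -
      obtain r where r: "r > 0" "\<And>\<theta>. \<theta> \<in> \<Theta> \<Longrightarrow> dist \<theta> \<theta>\<^sub>1 < r \<Longrightarrow> dist (\<phi> z \<theta>) (\<phi> z \<theta>\<^sub>1) < e"
        using continuous_on_\<phi>[of z] assms(1) e unfolding continuous_on_iff by blast
      have "\<bar>\<phi> z \<theta> $ k - \<phi> z \<theta>\<^sub>1 $ k\<bar> \<le> e" if "\<theta> \<in> \<Theta> \<inter> ball \<theta>\<^sub>1 r" for \<theta>
        using r(2)[of \<theta>] that component_le_norm_cart[of "\<phi> z \<theta> - \<phi> z \<theta>\<^sub>1" k]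
        by (simp add: dist_norm norm_minus_commute)
      with r(1) show ?thesis by blast
    qed
  qed (use \<open>c > 0\<close> in simp)
  then obtain r w where r: "r > 0" and w: "integrable F w" "(\<integral>z. w z \<partial>F) < c / 4"
    "\<And>z \<theta>. \<theta> \<in> \<Theta> \<inter> ball \<theta>\<^sub>1 r \<Longrightarrow> \<bar>\<phi> z \<theta> $ k - \<phi> z \<theta>\<^sub>1 $ k\<bar> \<le> w z"
    by blast
  have int1: "integrable F (\<lambda>z. \<phi> z \<theta>\<^sub>1 $ k)"
    by (intro integrable_vec_nth int_\<phi> assms)
  have "whp (\<lambda>n \<omega>. mean w n \<omega> < c / 4 \<and>
      \<bar>mean (\<lambda>z. \<phi> z \<theta>\<^sub>1 $ k) n \<omega> - (\<integral>z. \<phi> z \<theta>\<^sub>1 $ k \<partial>F)\<bar> \<le> c / 4)"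
    by (intro whp_conj whp_mean_less weak_law_of_large_numbers w(1,2) int1) (use \<open>c > 0\<close> in simp)
  then have "whp (\<lambda>n \<omega>. \<forall>\<theta>\<in>\<Theta> \<inter> ball \<theta>\<^sub>1 r. real n * (c / 4) < norm (\<Sum>j<n. \<phi> (Z j \<omega>) \<theta>))"
  proof (rule whp_eventually_mono)
    have "real n * (c / 4) < norm (\<Sum>j<n. \<phi> (Z j \<omega>) \<theta>)"
      if n: "n \<ge> 1" and w': "mean w n \<omega> < c / 4"
        and m: "\<bar>mean (\<lambda>z. \<phi> z \<theta>\<^sub>1 $ k) n \<omega> - (\<integral>z. \<phi> z \<theta>\<^sub>1 $ k \<partial>F)\<bar> \<le> c / 4"
        and \<theta>: "\<theta> \<in> \<Theta> \<inter> ball \<theta>\<^sub>1 r" for n \<omega> \<theta>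
    proof -
      have "\<bar>(\<Sum>j<n. \<phi> (Z j \<omega>) \<theta> $ k) - (\<Sum>j<n. \<phi> (Z j \<omega>) \<theta>\<^sub>1 $ k)\<bar> \<le> (\<Sum>j<n. w (Z j \<omega>))"
        unfolding sum_subtractf[symmetric] by (rule order_trans[OF sum_abs sum_mono]) (rule w(3)[OF \<theta>])
      then have "\<bar>mean (\<lambda>z. \<phi> z \<theta> $ k) n \<omega> - mean (\<lambda>z. \<phi> z \<theta>\<^sub>1 $ k) n \<omega>\<bar> \<le> mean w n \<omega>"
        using n by (simp add: mean_def diff_divide_distrib[symmetric] divide_right_mono)
      \<comment> \<open>The mean score has modulus \<open>c\<close> in coordinate \<open>k\<close>;
        the oscillation and the sampling error cost at most \<open>c / 4\<close> each.\<close>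
      then have "c / 2 < \<bar>mean (\<lambda>z. \<phi> z \<theta> $ k) n \<omega>\<bar>"
        using w' m unfolding c_def integral_vec_nth[OF int_\<phi>[OF assms(1)]] by linarith
      then have "real n * (c / 2) < \<bar>\<Sum>j<n. \<phi> (Z j \<omega>) \<theta> $ k\<bar>"
        using n by (simp add: mean_def field_simps)
      also have "\<dots> \<le> norm (\<Sum>j<n. \<phi> (Z j \<omega>) \<theta>)"
        using component_le_norm_cart[of "\<Sum>j<n. \<phi> (Z j \<omega>) \<theta>" k] by (simp add: sum_component)
      finally have "real n * (c / 2) < norm (\<Sum>j<n. \<phi> (Z j \<omega>) \<theta>)" .
      moreover have "real n * (c / 4) \<le> real n * (c / 2)"
        using \<open>c > 0\<close> by (intro mult_left_mono) auto
      ultimately show ?thesis by linarith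
    qed
    then show "\<forall>\<^sub>F n in sequentially. \<forall>\<omega>\<in>space M. mean w n \<omega> < c / 4 \<and>
      \<bar>mean (\<lambda>z. \<phi> z \<theta>\<^sub>1 $ k) n \<omega> - (\<integral>z. \<phi> z \<theta>\<^sub>1 $ k \<partial>F)\<bar> \<le> c / 4 \<longrightarrow>
      (\<forall>\<theta>\<in>\<Theta> \<inter> ball \<theta>\<^sub>1 r. real n * (c / 4) < norm (\<Sum>j<n. \<phi> (Z j \<omega>) \<theta>))"
      by (intro eventually_mono[OF eventually_ge_at_top[of 1]]) simp
  qed
  then show ?thesis using r \<open>c > 0\<close> by (intro exI[of _ r] exI[of _ "c / 4"] conjI) auto
qed

text \<open>Compactness reduces the claim to finitely many local bounds, whose exceptional events
  can be united.\<close>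

lemma whp_score_bounded_away:
  assumes "\<delta> > 0"
  shows "\<exists>c>0. whp (\<lambda>n \<omega>. \<forall>\<theta>\<in>\<Theta> - ball \<theta>\<^sub>0 \<delta>. real n * c < norm (\<Sum>j<n. \<phi> (Z j \<omega>) \<theta>))"
proof -
  \<comment> \<open>The triples carry centre, radius and level together, so that a finite subcover
    keeps the level belonging to each ball.\<close>
  define Q where "Q = (\<lambda>(p, r, c). c > 0 \<and>
    whp (\<lambda>n \<omega>. \<forall>\<theta>\<in>\<Theta> \<inter> ball p r. real n * c < norm (\<Sum>j<n. \<phi> (Z j \<omega>) \<theta>)))"
  have cover: "\<Theta> - ball \<theta>\<^sub>0 \<delta> \<subseteq> (\<Union>(p, r, c)\<in>Collect Q. ball p r)"
  proof
    fix p assume "p \<in> \<Theta> - ball \<theta>\<^sub>0 \<delta>"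
    then have "p \<in> \<Theta>" "p \<noteq> \<theta>\<^sub>0" using assms by auto
    then obtain r c where "r > 0" "Q (p, r, c)"
      using whp_score_bounded_away_local unfolding Q_def by blast
    then show "p \<in> (\<Union>(p, r, c)\<in>Collect Q. ball p r)"
      by (intro UN_I[of "(p, r, c)"]) auto
  qed
  have "compact (\<Theta> - ball \<theta>\<^sub>0 \<delta>)"
    using compact by (rule compact_diff) simp
  from compactE_image[OF this _ cover]
  obtain P where P: "P \<subseteq> Collect Q" "finite P" "\<Theta> - ball \<theta>\<^sub>0 \<delta> \<subseteq> (\<Union>(p, r, c)\<in>P. ball p r)"
    by (auto simp: split_beta)
  \<comment> \<open>The inserted 1 makes the minimum meaningful when the cover is empty.\<close>
  define c' where "c' = Min (insert 1 ((\<lambda>(p, r, c). c) ` P))"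
  have "c' > 0" unfolding c'_def using P(1,2) by (subst Min_gr_iff) (auto simp: Q_def)
  have c'le: "c' \<le> c" if "(p, r, c) \<in> P" for p r c
    unfolding c'_def using P(2) that by (intro Min_le) force+
  have "whp (\<lambda>n \<omega>. \<forall>q\<in>P. case q of (p, r, c) \<Rightarrow>
      \<forall>\<theta>\<in>\<Theta> \<inter> ball p r. real n * c < norm (\<Sum>j<n. \<phi> (Z j \<omega>) \<theta>))"
    using P(1) by (intro whp_finite_Ball P(2)) (auto simp: Q_def split_beta)
  then have "whp (\<lambda>n \<omega>. \<forall>\<theta>\<in>\<Theta> - ball \<theta>\<^sub>0 \<delta>. real n * c' < norm (\<Sum>j<n. \<phi> (Z j \<omega>) \<theta>))"
  proof (rule whp_mono, intro ballI)
    fix n \<omega> \<theta>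
    assume H: "\<forall>q\<in>P. case q of (p, r, c) \<Rightarrow>
        \<forall>\<theta>\<in>\<Theta> \<inter> ball p r. real n * c < norm (\<Sum>j<n. \<phi> (Z j \<omega>) \<theta>)"
      and \<theta>: "\<theta> \<in> \<Theta> - ball \<theta>\<^sub>0 \<delta>"
    obtain p r c where p: "(p, r, c) \<in> P" "\<theta> \<in> ball p r" using P(3) \<theta> by blast
    have "real n * c' \<le> real n * c" using c'le[OF p(1)] by (rule mult_left_mono) simp
    also have "\<dots> < norm (\<Sum>j<n. \<phi> (Z j \<omega>) \<theta>)" using H p \<theta> by blast
    finally show "real n * c' < norm (\<Sum>j<n. \<phi> (Z j \<omega>) \<theta>)" .
  qed
  with \<open>c' > 0\<close> show ?thesis by blast
qed

text \<open>One squared envelope is at most the sum of all of them, which is of order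
  \<open>n\<close>; the largest envelope is thus of order square root of \<open>n\<close> and falls
  below any multiple of \<open>n\<close>.\<close>

lemma whp_envelope_le:
  assumes "c > 0"
  shows "whp (\<lambda>n \<omega>. \<forall>i<n. m\<^sub>0 (Z i \<omega>) \<le> real n * c)"
proof -
  define E where "E = (\<integral>z. (m\<^sub>0 z)\<^sup>2 \<partial>F) + 1"
  have "whp (\<lambda>n \<omega>. mean (\<lambda>z. (m\<^sub>0 z)\<^sup>2) n \<omega> < E)"
    by (rule whp_mean_less[OF square_m\<^sub>0]) (simp add: E_def)
  then show ?thesis
  proof (rule whp_eventually_mono)
    have "0 < E" unfolding E_def by (intro add_nonneg_pos Bochner_Integration.integral_nonneg) simp_all
    then have "0 < E / c\<^sup>2" using \<open>c > 0\<close> by simp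
    moreover obtain N :: nat where "E / c\<^sup>2 < N" using reals_Archimedean2 by blast
    ultimately have N: "N > 0" "E / c\<^sup>2 < N" by (auto intro: gr0I)
    have "m\<^sub>0 (Z i \<omega>) \<le> real n * c" if n: "N \<le> n" and H: "mean (\<lambda>z. (m\<^sub>0 z)\<^sup>2) n \<omega> < E" and i: "i < n" for n i \<omega>
    proof -
      have "(m\<^sub>0 (Z i \<omega>))\<^sup>2 \<le> (\<Sum>j<n. (m\<^sub>0 (Z j \<omega>))\<^sup>2)"
        using i by (intro member_le_sum) auto
      also have "\<dots> < E * n" using H n N(1) by (simp add: mean_def field_simps)
      also have "\<dots> \<le> (n * c\<^sup>2) * n"
      proof (rule mult_right_mono)
        have "E < N * c\<^sup>2" using N(2) \<open>c > 0\<close> by (simp add: field_simps)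
        also have "\<dots> \<le> n * c\<^sup>2" using n by (intro mult_right_mono) auto
        finally show "E \<le> n * c\<^sup>2" by simp
      qed simp
      also have "\<dots> = (n * c)\<^sup>2" by (simp add: power2_eq_square)
      finally have "(m\<^sub>0 (Z i \<omega>))\<^sup>2 < (n * c)\<^sup>2" .
      then have "m\<^sub>0 (Z i \<omega>) < n * c"
        by (rule power2_less_imp_less) (use \<open>c > 0\<close> in simp)
      then show ?thesis by simp
    qed
    then show "\<forall>\<^sub>F n in sequentially. \<forall>\<omega>\<in>space M. mean (\<lambda>z. (m\<^sub>0 z)\<^sup>2) n \<omega> < E \<longrightarrow>
        (\<forall>i<n. m\<^sub>0 (Z i \<omega>) \<le> real n * c)"
      by (intro eventually_mono[OF eventually_ge_at_top[of N]]) simp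
  qed
qed

text \<open>The same constant \<open>c\<close> is used for both events: outside the ball the sample
  score exceeds \<open>real n * c\<close>, whereas at the estimators it is 0 or a single term
  bounded by \<open>real n * c\<close>. One exceptional event therefore serves all indices
  \<open>i\<close>.\<close>

lemma consistency:
  assumes "\<delta> > 0"
  shows "whp (\<lambda>n \<omega>. \<theta>hat n \<omega> \<in> ball \<theta>\<^sub>0 \<delta> \<and> (\<forall>i<n. \<theta>loo n i \<omega> \<in> ball \<theta>\<^sub>0 \<delta>))"
proof -
  obtain c where c: "c > 0"
    "whp (\<lambda>n \<omega>. \<forall>\<theta>\<in>\<Theta> - ball \<theta>\<^sub>0 \<delta>. real n * c < norm (\<Sum>j<n. \<phi> (Z j \<omega>) \<theta>))"
    using whp_score_bounded_away[OF assms] by blast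
  have "whp (\<lambda>n \<omega>. (\<forall>\<theta>\<in>\<Theta> - ball \<theta>\<^sub>0 \<delta>. real n * c < norm (\<Sum>j<n. \<phi> (Z j \<omega>) \<theta>)) \<and>
      (\<forall>i<n. m\<^sub>0 (Z i \<omega>) \<le> real n * c) \<and>
      (\<Sum>j<n. \<phi> (Z j \<omega>) (\<theta>hat n \<omega>)) = 0 \<and>
      (\<forall>i<n. (\<Sum>j<n. \<phi> (Z j \<omega>) (\<theta>loo n i \<omega>)) = \<phi> (Z i \<omega>) (\<theta>loo n i \<omega>)))"
    by (intro whp_conj[OF c(2)] whp_conj[OF whp_envelope_le[OF c(1)]] whp_estimating_eqs)
  then show ?thesis
  proof (rule whp_eventually_mono)
    have "\<theta>hat n \<omega> \<in> ball \<theta>\<^sub>0 \<delta> \<and> (\<forall>i<n. \<theta>loo n i \<omega> \<in> ball \<theta>\<^sub>0 \<delta>)"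
      if n: "n \<ge> 1" and \<omega>: "\<omega> \<in> space M"
        and a: "\<And>\<theta>. \<theta> \<in> \<Theta> - ball \<theta>\<^sub>0 \<delta> \<Longrightarrow> real n * c < norm (\<Sum>j<n. \<phi> (Z j \<omega>) \<theta>)"
        and m: "\<And>i. i < n \<Longrightarrow> m\<^sub>0 (Z i \<omega>) \<le> real n * c"
        and e: "(\<Sum>j<n. \<phi> (Z j \<omega>) (\<theta>hat n \<omega>)) = 0"
        and l: "\<And>i. i < n \<Longrightarrow> (\<Sum>j<n. \<phi> (Z j \<omega>) (\<theta>loo n i \<omega>)) = \<phi> (Z i \<omega>) (\<theta>loo n i \<omega>)" for n \<omega>
    proof (intro conjI allI impI)
      show "\<theta>hat n \<omega> \<in> ball \<theta>\<^sub>0 \<delta>"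
      proof (rule ccontr)
        assume "\<theta>hat n \<omega> \<notin> ball \<theta>\<^sub>0 \<delta>"
        with estimator[OF n \<omega>] have "real n * c < 0" using a[of "\<theta>hat n \<omega>"] e by simp
        moreover have "0 \<le> real n * c" using c(1) by simp
        ultimately show False by linarith
      qed
      fix i assume i: "i < n"
      show "\<theta>loo n i \<omega> \<in> ball \<theta>\<^sub>0 \<delta>"
      proof (rule ccontr)
        assume "\<theta>loo n i \<omega> \<notin> ball \<theta>\<^sub>0 \<delta>"
        with loo_estimator[OF i \<omega>] have "real n * c < norm (\<phi> (Z i \<omega>) (\<theta>loo n i \<omega>))"
          using a[of "\<theta>loo n i \<omega>"] l[OF i] by simp
        with bound_\<phi>[OF loo_estimator[OF i \<omega>], of "Z i \<omega>"] m[OF i] show False by linarith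
      qed
    qed
    then show "\<forall>\<^sub>F n in sequentially. \<forall>\<omega>\<in>space M.
      (\<forall>\<theta>\<in>\<Theta> - ball \<theta>\<^sub>0 \<delta>. real n * c < norm (\<Sum>j<n. \<phi> (Z j \<omega>) \<theta>)) \<and>
      (\<forall>i<n. m\<^sub>0 (Z i \<omega>) \<le> real n * c) \<and>
      (\<Sum>j<n. \<phi> (Z j \<omega>) (\<theta>hat n \<omega>)) = 0 \<and>
      (\<forall>i<n. (\<Sum>j<n. \<phi> (Z j \<omega>) (\<theta>loo n i \<omega>)) = \<phi> (Z i \<omega>) (\<theta>loo n i \<omega>)) \<longrightarrow>
      \<theta>hat n \<omega> \<in> ball \<theta>\<^sub>0 \<delta> \<and> (\<forall>i<n. \<theta>loo n i \<omega> \<in> ball \<theta>\<^sub>0 \<delta>)"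
      by (intro eventually_mono[OF eventually_ge_at_top[of 1]]) blast
  qed
qed

subsection \<open>The leave-one-out expansion\<close>

lemma has_derivative_\<phi>_nth:
  assumes "\<theta> \<in> \<Theta>"
  shows "((\<lambda>\<theta>. \<phi> z \<theta> $ k) has_derivative (\<lambda>h. D\<phi> z \<theta> $ k \<bullet> h)) (at \<theta> within \<Theta>)"
  using bounded_linear.has_derivative[OF bounded_linear_vec_nth[of k] deriv_\<phi>[OF assms, of z]]
  by (simp add: matrix_vector_mul_component)

text \<open>The envelope \<open>m\<^sub>1\<close> bounds columns, which are partial derivatives,
  while the gradient of a component of \<open>\<phi>\<close> is a row; the dimension factor pays for
  the change.\<close>

lemma norm_D\<phi>_nth_le:
  assumes "\<theta> \<in> \<Theta>"
  shows "norm (D\<phi> z \<theta> $ k) \<le> CARD('p) * m\<^sub>1 z"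
proof (rule norm_le_CARD_mult)
  fix l
  have "\<bar>D\<phi> z \<theta> $ k $ l\<bar> \<le> norm (column l (D\<phi> z \<theta>))"
    using component_le_norm_cart[of "column l (D\<phi> z \<theta>)" k] by (simp add: column_def)
  then show "\<bar>D\<phi> z \<theta> $ k $ l\<bar> \<le> m\<^sub>1 z"
    using bound_D\<phi>[OF assms, of l z] by linarith
qed

text \<open>The explicit factor 1 is the weight of \<open>uniform_strict_differentiability\<close>,
  taken constant here.\<close>

lemma \<phi>_nth_strictly_differentiable:
  assumes "\<epsilon> > 0"
  shows "\<exists>r>0. \<exists>w. integrable F w \<and> (\<forall>z. 0 \<le> w z) \<and> (\<integral>z. w z \<partial>F) < \<epsilon> \<and>
    (\<forall>z. \<forall>x\<in>ball \<theta>\<^sub>0 r. \<forall>y\<in>ball \<theta>\<^sub>0 r.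
       1 * \<bar>\<phi> z x $ k - \<phi> z y $ k - D\<phi> z \<theta>\<^sub>0 $ k \<bullet> (x - y)\<bar> \<le> w z * norm (x - y))"
proof (rule uniform_strict_differentiability[OF interior])
  show "(\<lambda>z. \<phi> z t $ k) \<in> borel_measurable F" if "t \<in> \<Theta>" for t
    using meas_\<phi>[OF that] by measurable
  show "isCont (\<lambda>\<theta>. D\<phi> z \<theta> $ k) \<theta>\<^sub>0" for z
    by (intro continuous_intros cont_D\<phi>)
  show "integrable F (\<lambda>z. 1 * (CARD('p) * m\<^sub>1 z))"
    using int_m\<^sub>1 by simp
qed (use assms has_derivative_\<phi>_nth norm_D\<phi>_nth_le in auto)

lemma integrable_D\<phi>_nth: "integrable F (\<lambda>z. D\<phi> z \<theta>\<^sub>0 $ k)"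
proof (rule Bochner_Integration.integrable_bound)
  show "integrable F (\<lambda>z. CARD('p) * m\<^sub>1 z)"
    using int_m\<^sub>1 by simp
  show "(\<lambda>z. D\<phi> z \<theta>\<^sub>0 $ k) \<in> borel_measurable F"
  proof (rule borel_measurable_gradient[OF interior])
    show "(\<lambda>z. \<phi> z t $ k) \<in> borel_measurable F" if "t \<in> \<Theta>" for t
      using meas_\<phi>[OF that] by measurable
    show "((\<lambda>\<theta>. \<phi> z \<theta> $ k) has_derivative (\<lambda>h. D\<phi> z \<theta>\<^sub>0 $ k \<bullet> h)) (at \<theta>\<^sub>0)" for z
      using has_derivative_\<phi>_nth[OF \<theta>\<^sub>0_mem, of z k] by (simp only: at_within_interior[OF interior])
  qed
  show "AE z in F. norm (D\<phi> z \<theta>\<^sub>0 $ k) \<le> norm (CARD('p) * m\<^sub>1 z)"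
    using norm_D\<phi>_nth_le[OF \<theta>\<^sub>0_mem] m\<^sub>1_nonneg by simp
qed

text \<open>Differentiation under the integral sign: integrating the strict differentiability bound
  shows that the mean of the gradient is a derivative of the mean score, and derivatives at a point
  are unique.\<close>

lemma integral_D\<phi>_nth: "(\<integral>z. D\<phi> z \<theta>\<^sub>0 $ k \<partial>F) = A $ k"
proof -
  define G where "G = (\<integral>z. D\<phi> z \<theta>\<^sub>0 $ k \<partial>F)"
  define f where "f \<theta> = (\<integral>z. \<phi> z \<theta> \<partial>F) $ k" for \<theta>
  obtain e where e: "e > 0" "ball \<theta>\<^sub>0 e \<subseteq> \<Theta>"
    using interior unfolding mem_interior by blast
  have "(f has_derivative (\<lambda>h. G \<bullet> h)) (at \<theta>\<^sub>0)"
    unfolding has_derivative_at_alt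
  proof (intro conjI allI impI)
    show "bounded_linear (\<lambda>h. G \<bullet> h)" by (rule bounded_linear_inner_right)
    fix \<epsilon> :: real assume "\<epsilon> > 0"
    then obtain r w where r: "r > 0" and w: "integrable F w" "(\<integral>z. w z \<partial>F) < \<epsilon>"
      "\<And>z x y. x \<in> ball \<theta>\<^sub>0 r \<Longrightarrow> y \<in> ball \<theta>\<^sub>0 r \<Longrightarrow>
         \<bar>\<phi> z x $ k - \<phi> z y $ k - D\<phi> z \<theta>\<^sub>0 $ k \<bullet> (x - y)\<bar> \<le> w z * norm (x - y)"
      using \<phi>_nth_strictly_differentiable[of \<epsilon> k] unfolding mult_1 by blast
    have "norm (f y - f \<theta>\<^sub>0 - G \<bullet> (y - \<theta>\<^sub>0)) \<le> \<epsilon> * norm (y - \<theta>\<^sub>0)" if y: "norm (y - \<theta>\<^sub>0) < min r e" for y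
    proof -
      have "y \<in> ball \<theta>\<^sub>0 e" "y \<in> ball \<theta>\<^sub>0 r" using y by (simp_all add: dist_norm norm_minus_commute)
      then have "y \<in> \<Theta>" using e(2) by blast
      note int = integrable_vec_nth[OF int_\<phi>[OF \<open>y \<in> \<Theta>\<close>], of k] integrable_vec_nth[OF int_\<phi>[OF \<theta>\<^sub>0_mem], of k]
        integrable_bounded_linear[OF bounded_linear_inner_left[of "y - \<theta>\<^sub>0"] integrable_D\<phi>_nth[of k]]
      have "f y - f \<theta>\<^sub>0 - G \<bullet> (y - \<theta>\<^sub>0) = (\<integral>z. \<phi> z y $ k - \<phi> z \<theta>\<^sub>0 $ k - D\<phi> z \<theta>\<^sub>0 $ k \<bullet> (y - \<theta>\<^sub>0) \<partial>F)"
        using int integrable_D\<phi>_nth[of k]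
        by (simp add: f_def G_def integral_vec_nth[OF int_\<phi>] \<open>y \<in> \<Theta>\<close> \<theta>\<^sub>0_mem)
      also have "norm \<dots> \<le> (\<integral>z. w z * norm (y - \<theta>\<^sub>0) \<partial>F)"
      proof (rule order_trans[OF integral_norm_bound integral_mono])
        show "norm (\<phi> z y $ k - \<phi> z \<theta>\<^sub>0 $ k - D\<phi> z \<theta>\<^sub>0 $ k \<bullet> (y - \<theta>\<^sub>0)) \<le> w z * norm (y - \<theta>\<^sub>0)" for z
          using w(3)[OF \<open>y \<in> ball \<theta>\<^sub>0 r\<close>, of \<theta>\<^sub>0 z] r by simp
      qed (use int w(1) in simp_all)
      also have "\<dots> \<le> \<epsilon> * norm (y - \<theta>\<^sub>0)"
        using w(1,2) by (simp add: mult_right_mono)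
      finally show ?thesis .
    qed
    then show "\<exists>d>0. \<forall>y. norm (y - \<theta>\<^sub>0) < d \<longrightarrow>
        norm (f y - f \<theta>\<^sub>0 - G \<bullet> (y - \<theta>\<^sub>0)) \<le> \<epsilon> * norm (y - \<theta>\<^sub>0)"
      using r e(1) by (intro exI[of _ "min r e"]) simp
  qed
  moreover have "(f has_derivative (\<lambda>h. A $ k \<bullet> h)) (at \<theta>\<^sub>0)"
    unfolding f_def using bounded_linear.has_derivative[OF bounded_linear_vec_nth[of k] deriv_E\<phi>]
    by (simp add: matrix_vector_mul_component)
  ultimately have "(\<lambda>h. G \<bullet> h) = (\<lambda>h. A $ k \<bullet> h)"
    by (rule has_derivative_unique)
  then show ?thesis
    unfolding G_def[symmetric] by (metis vector_eq_rdot)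
qed

text \<open>In each coordinate the remainder is summed through its envelope, uniformly in
  \<open>x\<close> and \<open>y\<close>, and the summed gradients at \<open>\<theta>\<^sub>0\<close>
  are compared with \<open>A\<close> by the law of large numbers.\<close>

lemma whp_score_strict_derivative:
  assumes "\<epsilon> > 0"
  shows "\<exists>\<delta>>0. whp (\<lambda>n \<omega>. \<forall>x\<in>ball \<theta>\<^sub>0 \<delta>. \<forall>y\<in>ball \<theta>\<^sub>0 \<delta>.
    norm ((\<Sum>j<n. \<phi> (Z j \<omega>) x) - (\<Sum>j<n. \<phi> (Z j \<omega>) y) - real n *\<^sub>R (A *v (x - y)))
      \<le> real n * \<epsilon> * norm (x - y))"
proof -
  define p where "p = real CARD('p)"
  have "p > 0" unfolding p_def by simp
  \<comment> \<open>Per coordinate the remainder costs \<open>e\<close> and the gradient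
    \<open>p * e\<close>; passing from coordinates to the norm costs another factor
    \<open>p\<close>.\<close>
  define e where "e = \<epsilon> / (p * (1 + p))"
  have "e > 0" using assms \<open>p > 0\<close> by (simp add: e_def)
  have comp: "\<exists>\<delta>>0. whp (\<lambda>n \<omega>. \<forall>x\<in>ball \<theta>\<^sub>0 \<delta>. \<forall>y\<in>ball \<theta>\<^sub>0 \<delta>.
      \<bar>(\<Sum>j<n. \<phi> (Z j \<omega>) x $ k) - (\<Sum>j<n. \<phi> (Z j \<omega>) y $ k) - n * (A $ k \<bullet> (x - y))\<bar>
        \<le> n * (e * (1 + p)) * norm (x - y))" for k
  proof -
    obtain r w where r: "r > 0" and w: "integrable F w" "(\<integral>z. w z \<partial>F) < e"
      "\<And>z x y. x \<in> ball \<theta>\<^sub>0 r \<Longrightarrow> y \<in> ball \<theta>\<^sub>0 r \<Longrightarrow>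
         \<bar>\<phi> z x $ k - \<phi> z y $ k - D\<phi> z \<theta>\<^sub>0 $ k \<bullet> (x - y)\<bar> \<le> w z * norm (x - y)"
      using \<phi>_nth_strictly_differentiable[OF \<open>e > 0\<close>, of k] unfolding mult_1 by blast
    have "whp (\<lambda>n \<omega>. mean w n \<omega> < e \<and>
        (\<forall>l\<in>UNIV. \<bar>mean (\<lambda>z. D\<phi> z \<theta>\<^sub>0 $ k $ l) n \<omega> - (\<integral>z. D\<phi> z \<theta>\<^sub>0 $ k $ l \<partial>F)\<bar> \<le> e))"
      by (intro whp_conj whp_finite_Ball whp_mean_less weak_law_of_large_numbers w(1,2) \<open>e > 0\<close> finite
          integrable_vec_nth integrable_D\<phi>_nth)
    then have "whp (\<lambda>n \<omega>. \<forall>x\<in>ball \<theta>\<^sub>0 r. \<forall>y\<in>ball \<theta>\<^sub>0 r.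
      \<bar>(\<Sum>j<n. \<phi> (Z j \<omega>) x $ k) - (\<Sum>j<n. \<phi> (Z j \<omega>) y $ k) - n * (A $ k \<bullet> (x - y))\<bar>
        \<le> n * (e * (1 + p)) * norm (x - y))"
    proof (rule whp_eventually_mono)
      have "\<bar>(\<Sum>j<n. \<phi> (Z j \<omega>) x $ k) - (\<Sum>j<n. \<phi> (Z j \<omega>) y $ k) - n * (A $ k \<bullet> (x - y))\<bar>
          \<le> n * (e * (1 + p)) * norm (x - y)"
        if n: "n \<ge> 1" and mw: "mean w n \<omega> < e"
          and mD: "\<And>l. \<bar>mean (\<lambda>z. D\<phi> z \<theta>\<^sub>0 $ k $ l) n \<omega> - (\<integral>z. D\<phi> z \<theta>\<^sub>0 $ k $ l \<partial>F)\<bar> \<le> e"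
          and x: "x \<in> ball \<theta>\<^sub>0 r" and y: "y \<in> ball \<theta>\<^sub>0 r" for n \<omega> x y
      proof -
        define S where "S = (\<Sum>j<n. D\<phi> (Z j \<omega>) \<theta>\<^sub>0 $ k)"
        have "\<bar>(\<Sum>j<n. \<phi> (Z j \<omega>) x $ k) - (\<Sum>j<n. \<phi> (Z j \<omega>) y $ k) - S \<bullet> (x - y)\<bar>
            \<le> (\<Sum>j<n. w (Z j \<omega>) * norm (x - y))"
          unfolding S_def inner_sum_left sum_subtractf[symmetric]
          by (rule order_trans[OF sum_abs sum_mono]) (rule w(3)[OF x y])
        also have "\<dots> = (n * mean w n \<omega>) * norm (x - y)"
          using n by (simp add: mean_def sum_distrib_right)
        also have "\<dots> \<le> (n * e) * norm (x - y)"
          using mw by (intro mult_right_mono mult_left_mono) auto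
        finally have 1: "\<bar>(\<Sum>j<n. \<phi> (Z j \<omega>) x $ k) - (\<Sum>j<n. \<phi> (Z j \<omega>) y $ k) - S \<bullet> (x - y)\<bar>
            \<le> n * e * norm (x - y)" .
        have "norm (S - real n *\<^sub>R A $ k) \<le> real CARD('p) * (n * e)"
        proof (rule norm_le_CARD_mult)
          fix l
          have "(\<integral>z. D\<phi> z \<theta>\<^sub>0 $ k $ l \<partial>F) = A $ k $ l"
            by (simp add: integral_vec_nth[OF integrable_D\<phi>_nth] integral_D\<phi>_nth)
          then have "(S - real n *\<^sub>R A $ k) $ l = n * (mean (\<lambda>z. D\<phi> z \<theta>\<^sub>0 $ k $ l) n \<omega> - (\<integral>z. D\<phi> z \<theta>\<^sub>0 $ k $ l \<partial>F))"
            using n by (simp add: S_def mean_def right_diff_distrib sum_component)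
          then show "\<bar>(S - real n *\<^sub>R A $ k) $ l\<bar> \<le> n * e"
            using mD[of l] by (simp add: abs_mult mult_left_mono)
        qed
        then have "\<bar>(S - real n *\<^sub>R A $ k) \<bullet> (x - y)\<bar> \<le> p * (n * e) * norm (x - y)"
          unfolding p_def by (rule order_trans[OF Cauchy_Schwarz_ineq2 mult_right_mono]) simp
        then have 2: "\<bar>S \<bullet> (x - y) - n * (A $ k \<bullet> (x - y))\<bar> \<le> p * (n * e) * norm (x - y)"
          by (simp only: inner_diff_left inner_scaleR_left)
        have "n * (e * (1 + p)) * norm (x - y) = n * e * norm (x - y) + p * (n * e) * norm (x - y)"
          by (simp add: algebra_simps)
        with 1 2 show ?thesis by linarith
      qed
      then show "\<forall>\<^sub>F n in sequentially. \<forall>\<omega>\<in>space M. mean w n \<omega> < e \<and>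
          (\<forall>l\<in>UNIV. \<bar>mean (\<lambda>z. D\<phi> z \<theta>\<^sub>0 $ k $ l) n \<omega> - (\<integral>z. D\<phi> z \<theta>\<^sub>0 $ k $ l \<partial>F)\<bar> \<le> e) \<longrightarrow>
          (\<forall>x\<in>ball \<theta>\<^sub>0 r. \<forall>y\<in>ball \<theta>\<^sub>0 r.
            \<bar>(\<Sum>j<n. \<phi> (Z j \<omega>) x $ k) - (\<Sum>j<n. \<phi> (Z j \<omega>) y $ k) - n * (A $ k \<bullet> (x - y))\<bar>
              \<le> n * (e * (1 + p)) * norm (x - y))"
        by (intro eventually_mono[OF eventually_ge_at_top[of 1]]) simp
    qed
    with r show ?thesis by blast
  qed
  define P where "P k \<delta> n \<omega> \<longleftrightarrow> (\<forall>x\<in>ball \<theta>\<^sub>0 \<delta>. \<forall>y\<in>ball \<theta>\<^sub>0 \<delta>.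
      \<bar>(\<Sum>j<n. \<phi> (Z j \<omega>) x $ k) - (\<Sum>j<n. \<phi> (Z j \<omega>) y $ k) - n * (A $ k \<bullet> (x - y))\<bar>
        \<le> n * (e * (1 + p)) * norm (x - y))" for k \<delta> n \<omega>
  have "\<forall>k. \<exists>\<delta>. \<delta> > 0 \<and> whp (P k \<delta>)"
    using comp unfolding P_def by blast
  then obtain \<delta> where \<delta>: "\<And>k. \<delta> k > 0" "\<And>k. whp (P k (\<delta> k))"
    by (auto dest!: choice)
  \<comment> \<open>The radius depends on the coordinate; the smallest of the finitely many serves
    all.\<close>
  define d where "d = Min (range \<delta>)"
  have "d > 0" unfolding d_def by (subst Min_gr_iff) (auto simp: \<delta>)
  have d_le: "d \<le> \<delta> k" for k unfolding d_def by (rule Min_le) auto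
  have "whp (\<lambda>n \<omega>. \<forall>k\<in>UNIV. P k (\<delta> k) n \<omega>)"
    by (rule whp_finite_Ball) (auto intro: \<delta>)
  then have "whp (\<lambda>n \<omega>. \<forall>x\<in>ball \<theta>\<^sub>0 d. \<forall>y\<in>ball \<theta>\<^sub>0 d.
    norm ((\<Sum>j<n. \<phi> (Z j \<omega>) x) - (\<Sum>j<n. \<phi> (Z j \<omega>) y) - real n *\<^sub>R (A *v (x - y)))
      \<le> real n * \<epsilon> * norm (x - y))"
  proof (rule whp_mono, intro ballI)
    fix n \<omega> x y
    assume H: "\<forall>k\<in>UNIV. P k (\<delta> k) n \<omega>" and xy: "x \<in> ball \<theta>\<^sub>0 d" "y \<in> ball \<theta>\<^sub>0 d"
    have "norm ((\<Sum>j<n. \<phi> (Z j \<omega>) x) - (\<Sum>j<n. \<phi> (Z j \<omega>) y) - real n *\<^sub>R (A *v (x - y)))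
        \<le> real CARD('p) * (n * (e * (1 + p)) * norm (x - y))"
    proof (rule norm_le_CARD_mult)
      fix k
      have "x \<in> ball \<theta>\<^sub>0 (\<delta> k)" "y \<in> ball \<theta>\<^sub>0 (\<delta> k)"
        using xy d_le[of k] by auto
      with H show "\<bar>((\<Sum>j<n. \<phi> (Z j \<omega>) x) - (\<Sum>j<n. \<phi> (Z j \<omega>) y) - real n *\<^sub>R (A *v (x - y))) $ k\<bar>
          \<le> n * (e * (1 + p)) * norm (x - y)"
        unfolding P_def by (simp add: sum_component matrix_vector_mul_component)
    qed
    also have "\<dots> = real n * (p * (e * (1 + p))) * norm (x - y)"
      by (simp add: p_def)
    also have "p * (e * (1 + p)) = \<epsilon>"
      using \<open>p > 0\<close> add_pos_pos[OF zero_less_one \<open>p > 0\<close>] by (simp add: e_def)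
    finally show "norm ((\<Sum>j<n. \<phi> (Z j \<omega>) x) - (\<Sum>j<n. \<phi> (Z j \<omega>) y) - real n *\<^sub>R (A *v (x - y)))
      \<le> real n * \<epsilon> * norm (x - y)" .
  qed
  with \<open>d > 0\<close> show ?thesis by blast
qed

text \<open>Subtracting the two estimating equations gives \<open>solve_perturbed_linear\<close>
  with matrix \<open>- A\<close>, scale \<open>n\<close>, unknown the displacement and
  \<open>v\<close> the deleted term, which the envelope of the same observation bounds.\<close>

lemma whp_loo_displacement:
  assumes B: "B ** (- A) = mat 1" and K: "\<And>x. norm (B *v x) \<le> K * norm x" "K > 0"
    and "\<epsilon> > 0"
  shows "whp (\<lambda>n \<omega>. \<forall>i<n.
    real n * norm (\<theta>loo n i \<omega> - \<theta>hat n \<omega>) \<le> 2 * K * m\<^sub>0 (Z i \<omega>) \<and>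
    norm (B *v \<phi> (Z i \<omega>) (\<theta>loo n i \<omega>) + real n *\<^sub>R (\<theta>loo n i \<omega> - \<theta>hat n \<omega>)) \<le> \<epsilon> * m\<^sub>0 (Z i \<omega>))"
proof -
  \<comment> \<open>The first entry ensures the absorption condition
    \<open>K * e \<le> 1 / 2\<close>, the second brings the final error down to
    \<open>\<epsilon>\<close>.\<close>
  define e where "e = min (1 / (2 * K)) (\<epsilon> / (2 * K\<^sup>2))"
  have e: "e > 0" "K * e \<le> 1 / 2" "2 * K\<^sup>2 * e \<le> \<epsilon>"
    using \<open>K > 0\<close> \<open>\<epsilon> > 0\<close> by (auto simp: e_def min_def field_simps)
  obtain \<delta> where \<delta>: "\<delta> > 0" and D: "whp (\<lambda>n \<omega>. \<forall>x\<in>ball \<theta>\<^sub>0 \<delta>. \<forall>y\<in>ball \<theta>\<^sub>0 \<delta>.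
    norm ((\<Sum>j<n. \<phi> (Z j \<omega>) x) - (\<Sum>j<n. \<phi> (Z j \<omega>) y) - real n *\<^sub>R (A *v (x - y)))
      \<le> real n * e * norm (x - y))"
    using whp_score_strict_derivative[OF e(1)] by blast
  have "whp (\<lambda>n \<omega>. (\<forall>x\<in>ball \<theta>\<^sub>0 \<delta>. \<forall>y\<in>ball \<theta>\<^sub>0 \<delta>.
      norm ((\<Sum>j<n. \<phi> (Z j \<omega>) x) - (\<Sum>j<n. \<phi> (Z j \<omega>) y) - real n *\<^sub>R (A *v (x - y)))
        \<le> real n * e * norm (x - y)) \<and>
    (\<theta>hat n \<omega> \<in> ball \<theta>\<^sub>0 \<delta> \<and> (\<forall>i<n. \<theta>loo n i \<omega> \<in> ball \<theta>\<^sub>0 \<delta>)) \<and>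
    ((\<Sum>j<n. \<phi> (Z j \<omega>) (\<theta>hat n \<omega>)) = 0 \<and>
     (\<forall>i<n. (\<Sum>j<n. \<phi> (Z j \<omega>) (\<theta>loo n i \<omega>)) = \<phi> (Z i \<omega>) (\<theta>loo n i \<omega>))))"
    by (intro whp_conj[OF D] whp_conj[OF consistency[OF \<delta>]] whp_estimating_eqs)
  then show ?thesis
  proof (rule whp_mono, intro allI impI)
    fix n i \<omega>
    assume \<omega>: "\<omega> \<in> space M" and "i < n" and H: "(\<forall>x\<in>ball \<theta>\<^sub>0 \<delta>. \<forall>y\<in>ball \<theta>\<^sub>0 \<delta>.
      norm ((\<Sum>j<n. \<phi> (Z j \<omega>) x) - (\<Sum>j<n. \<phi> (Z j \<omega>) y) - real n *\<^sub>R (A *v (x - y)))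
        \<le> real n * e * norm (x - y)) \<and>
      (\<theta>hat n \<omega> \<in> ball \<theta>\<^sub>0 \<delta> \<and> (\<forall>i<n. \<theta>loo n i \<omega> \<in> ball \<theta>\<^sub>0 \<delta>)) \<and>
      ((\<Sum>j<n. \<phi> (Z j \<omega>) (\<theta>hat n \<omega>)) = 0 \<and>
       (\<forall>i<n. (\<Sum>j<n. \<phi> (Z j \<omega>) (\<theta>loo n i \<omega>)) = \<phi> (Z i \<omega>) (\<theta>loo n i \<omega>)))"
    define a where "a = \<theta>loo n i \<omega> - \<theta>hat n \<omega>"
    define v where "v = \<phi> (Z i \<omega>) (\<theta>loo n i \<omega>)"
    have "norm ((\<Sum>j<n. \<phi> (Z j \<omega>) (\<theta>loo n i \<omega>)) - (\<Sum>j<n. \<phi> (Z j \<omega>) (\<theta>hat n \<omega>)) - real n *\<^sub>R (A *v a))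
        \<le> real n * e * norm a"
      unfolding a_def using H \<open>i < n\<close> by blast
    moreover have "(\<Sum>j<n. \<phi> (Z j \<omega>) (\<theta>loo n i \<omega>)) = v" "(\<Sum>j<n. \<phi> (Z j \<omega>) (\<theta>hat n \<omega>)) = 0"
      using H \<open>i < n\<close> unfolding v_def by blast+
    moreover have "(- A) *v a = - (A *v a)"
      by (simp add: vec_eq_iff matrix_vector_mult_def sum_negf)
    ultimately have le: "norm (v + real n *\<^sub>R ((- A) *v a)) \<le> real n * e * norm a"
      by simp
    have n: "real n > 0" using \<open>i < n\<close> by simp
    note * = solve_perturbed_linear[OF B K(1) less_imp_le[OF K(2)] n less_imp_le[OF e(1)] e(2) le]
    have v: "norm v \<le> m\<^sub>0 (Z i \<omega>)"
      unfolding v_def by (rule bound_\<phi>[OF loo_estimator[OF \<open>i < n\<close> \<omega>]])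
    have "real n * norm a \<le> 2 * K * m\<^sub>0 (Z i \<omega>)"
      using *(1) v \<open>K > 0\<close> by (intro order_trans[OF *(1)] mult_left_mono) auto
    moreover have "2 * K\<^sup>2 * e * norm v \<le> \<epsilon> * m\<^sub>0 (Z i \<omega>)"
      using e(3) v \<open>\<epsilon> > 0\<close> by (intro mult_mono) auto
    ultimately show "real n * norm (\<theta>loo n i \<omega> - \<theta>hat n \<omega>) \<le> 2 * K * m\<^sub>0 (Z i \<omega>) \<and>
      norm (B *v \<phi> (Z i \<omega>) (\<theta>loo n i \<omega>) + real n *\<^sub>R (\<theta>loo n i \<omega> - \<theta>hat n \<omega>)) \<le> \<epsilon> * m\<^sub>0 (Z i \<omega>)"
      using *(2) unfolding a_def[symmetric] v_def[symmetric] by linarith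
  qed
qed

text \<open>With \<open>q\<close> the envelope of the gradient of \<open>\<psi>\<close>, this prices
  the replacement of a leave-one-out estimator by \<open>\<theta>\<^sub>0\<close> inside
  \<open>\<phi>\<close>.\<close>

lemma uniform_local_bound_\<phi>:
  assumes q: "q \<in> borel_measurable F" "\<And>z. 0 \<le> q z" and int: "integrable F (\<lambda>z. q z * m\<^sub>0 z)"
    and "\<epsilon> > 0"
  shows "\<exists>r>0. \<exists>w. integrable F w \<and> (\<forall>z. 0 \<le> w z) \<and> (\<integral>z. w z \<partial>F) < \<epsilon> \<and>
    (\<forall>z. \<forall>\<theta>\<in>\<Theta> \<inter> ball \<theta>\<^sub>0 r. \<bar>q z * norm (\<phi> z \<theta> - \<phi> z \<theta>\<^sub>0)\<bar> \<le> w z)"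
proof (rule uniform_local_bound)
  show "(\<lambda>z. q z * norm (\<phi> z \<theta> - \<phi> z \<theta>\<^sub>0)) \<in> borel_measurable F" if "\<theta> \<in> \<Theta>" for \<theta>
    using q(1) meas_\<phi>[OF that] meas_\<phi>[OF \<theta>\<^sub>0_mem] by measurable
  show "continuous_on \<Theta> (\<lambda>\<theta>. q z * norm (\<phi> z \<theta> - \<phi> z \<theta>\<^sub>0))" for z
    by (intro continuous_intros continuous_on_\<phi>)
  show "integrable F (\<lambda>z. 2 * (q z * m\<^sub>0 z))" using int by simp
  show "\<bar>q z * norm (\<phi> z \<theta> - \<phi> z \<theta>\<^sub>0)\<bar> \<le> 2 * (q z * m\<^sub>0 z)" if "\<theta> \<in> \<Theta>" for z \<theta>
  proof -
    have "norm (\<phi> z \<theta> - \<phi> z \<theta>\<^sub>0) \<le> 2 * m\<^sub>0 z"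
      using norm_triangle_ineq4[of "\<phi> z \<theta>" "\<phi> z \<theta>\<^sub>0"] bound_\<phi>[OF that, of z] bound_\<phi>[OF \<theta>\<^sub>0_mem, of z]
      by linarith
    then show ?thesis using q(2)[of z] mult_left_mono[OF _ q(2)[of z]] by (fastforce simp: abs_mult)
  qed
  show "\<exists>r>0. \<forall>\<theta>\<in>\<Theta> \<inter> ball \<theta>\<^sub>0 r. \<bar>q z * norm (\<phi> z \<theta> - \<phi> z \<theta>\<^sub>0)\<bar> \<le> e" if e: "e > 0" for z e
  proof -
    have "e / (q z + 1) > 0" using e q(2)[of z] by simp
    then obtain r where r: "r > 0" "\<And>\<theta>. \<theta> \<in> \<Theta> \<Longrightarrow> dist \<theta> \<theta>\<^sub>0 < r \<Longrightarrow> dist (\<phi> z \<theta>) (\<phi> z \<theta>\<^sub>0) < e / (q z + 1)"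
      using continuous_on_\<phi>[of z] \<theta>\<^sub>0_mem unfolding continuous_on_iff by blast
    have "\<bar>q z * norm (\<phi> z \<theta> - \<phi> z \<theta>\<^sub>0)\<bar> \<le> e" if "\<theta> \<in> \<Theta> \<inter> ball \<theta>\<^sub>0 r" for \<theta>
    proof -
      have "norm (\<phi> z \<theta> - \<phi> z \<theta>\<^sub>0) < e / (q z + 1)"
        using r(2)[of \<theta>] that by (simp add: dist_norm norm_minus_commute)
      then have "q z * norm (\<phi> z \<theta> - \<phi> z \<theta>\<^sub>0) \<le> q z * (e / (q z + 1))"
        using q(2)[of z] by (intro mult_left_mono) auto
      also have "\<dots> \<le> e" using e q(2)[of z] by (simp add: field_simps)
      finally show ?thesis using q(2)[of z] by simp
    qed
    with r(1) show ?thesis by blast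
  qed
qed (rule \<open>\<epsilon> > 0\<close>)

text \<open>The sum is \<open>n\<close> times the difference of the two averages, so the claimed
  rate becomes plain convergence in probability. Each summand is
  \<open>- q (Z i \<omega>) / n\<close> up to an error made of envelopes, and the sample mean of
  \<open>q\<close> tends to the trace.\<close>

lemma whp_loo_expansion:
  fixes \<psi> :: "'z \<Rightarrow> real^'p \<Rightarrow> real" and grad\<psi> :: "'z \<Rightarrow> real^'p \<Rightarrow> real^'p" and p\<^sub>2 :: "'z \<Rightarrow> real"
  assumes meas_\<psi>: "\<And>\<theta>. \<theta> \<in> \<Theta> \<Longrightarrow> (\<lambda>z. \<psi> z \<theta>) \<in> borel_measurable F"
    and deriv_\<psi>: "\<And>z \<theta>. \<theta> \<in> \<Theta> \<Longrightarrow> (\<psi> z has_derivative (\<lambda>h. grad\<psi> z \<theta> \<bullet> h)) (at \<theta> within \<Theta>)"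
    and cont_grad\<psi>: "\<And>z. isCont (grad\<psi> z) \<theta>\<^sub>0"
    and bound_grad\<psi>: "\<And>z \<theta>. \<theta> \<in> \<Theta> \<Longrightarrow> norm (grad\<psi> z \<theta>) \<le> p\<^sub>2 z"
    and meas_p\<^sub>2: "p\<^sub>2 \<in> borel_measurable F" and square_p\<^sub>2: "integrable F (\<lambda>z. (p\<^sub>2 z)\<^sup>2)"
    and "\<epsilon> > 0"
  shows "whp (\<lambda>n \<omega>. \<bar>(\<Sum>i<n. \<psi> (Z i \<omega>) (\<theta>loo n i \<omega>) - \<psi> (Z i \<omega>) (\<theta>hat n \<omega>))
    + trace (matrix_inv (- A) ** (\<integral>z. (\<chi> a b. \<phi> z \<theta>\<^sub>0 $ a * grad\<psi> z \<theta>\<^sub>0 $ b) \<partial>F))\<bar> \<le> \<epsilon>)"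
proof -
  define B where "B = matrix_inv (- A)"
  define \<tau> where "\<tau> = trace (B ** (\<integral>z. (\<chi> a b. \<phi> z \<theta>\<^sub>0 $ a * grad\<psi> z \<theta>\<^sub>0 $ b) \<partial>F))"
  define q where "q z = grad\<psi> z \<theta>\<^sub>0 \<bullet> (B *v \<phi> z \<theta>\<^sub>0)" for z
  have "invertible (- A)"
  proof -
    from invertible_A obtain A' where "A ** A' = mat 1" "A' ** A = mat 1"
      unfolding invertible_def by blast
    then show ?thesis
      unfolding invertible_def
      by (intro exI[of _ "- A'"]) (simp add: matrix_matrix_mult_def)
  qed
  then have B: "B ** (- A) = mat 1"
    unfolding B_def matrix_inv_def invertible_def by (rule someI_ex[THEN conjunct2])
  obtain K where K: "K > 0" "\<And>x. norm (B *v x) \<le> K * norm x"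
    using bounded_linear.pos_bounded[OF matrix_vector_mul_bounded_linear[of B]] by (auto simp: mult.commute)
  have p2: "0 \<le> p\<^sub>2 z" for z
    by (rule order_trans[OF norm_ge_zero bound_grad\<psi>[OF \<theta>\<^sub>0_mem]])
  have pm: "integrable F (\<lambda>z. p\<^sub>2 z * m\<^sub>0 z)"
    by (rule integrable_mult_of_squares[OF meas_p\<^sub>2 meas_m\<^sub>0 square_p\<^sub>2 square_m\<^sub>0])
  have meas_grad: "(\<lambda>z. grad\<psi> z \<theta>\<^sub>0) \<in> borel_measurable F"
    by (rule borel_measurable_gradient[OF interior meas_\<psi>])
      (use deriv_\<psi>[OF \<theta>\<^sub>0_mem] in \<open>simp_all add: at_within_interior[OF interior]\<close>)
  have "integrable F (\<lambda>z. norm (\<phi> z \<theta>\<^sub>0) * norm (grad\<psi> z \<theta>\<^sub>0))"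
  proof (rule Bochner_Integration.integrable_bound[OF pm])
    show "(\<lambda>z. norm (\<phi> z \<theta>\<^sub>0) * norm (grad\<psi> z \<theta>\<^sub>0)) \<in> borel_measurable F"
      using meas_\<phi>[OF \<theta>\<^sub>0_mem] meas_grad by measurable
    have "norm (\<phi> z \<theta>\<^sub>0) * norm (grad\<psi> z \<theta>\<^sub>0) \<le> m\<^sub>0 z * p\<^sub>2 z" for z
      by (intro mult_mono bound_\<phi> bound_grad\<psi> \<theta>\<^sub>0_mem m\<^sub>0_nonneg) simp
    then show "AE z in F. norm (norm (\<phi> z \<theta>\<^sub>0) * norm (grad\<psi> z \<theta>\<^sub>0)) \<le> norm (p\<^sub>2 z * m\<^sub>0 z)"
      using p2 m\<^sub>0_nonneg by (simp add: abs_mult mult.commute)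
  qed
  from integral_trace_mult_outer_product[OF meas_\<phi>[OF \<theta>\<^sub>0_mem] meas_grad this, of B]
  have q: "integrable F q" "(\<integral>z. q z \<partial>F) = \<tau>"
    unfolding q_def \<tau>_def by simp_all

  define E where "E = (\<integral>z. p\<^sub>2 z * m\<^sub>0 z \<partial>F) + 1"
  have "E > 0" unfolding E_def
    using p2 m\<^sub>0_nonneg by (intro add_nonneg_pos Bochner_Integration.integral_nonneg) simp_all
  \<comment> \<open>This adds up the coefficients of \<open>e\<close> in the final estimate:
    \<open>2 * K\<close> from linearising \<open>\<psi>\<close>, \<open>E\<close> from the
    displacement, \<open>K\<close> from moving \<open>\<phi>\<close> to
    \<open>\<theta>\<^sub>0\<close>, and 1 from the law of large numbers for
    \<open>q\<close>.\<close>
  define s where "s = 3 * K + E + 1"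
  have "s > 0" unfolding s_def using \<open>K > 0\<close> \<open>E > 0\<close> by simp
  define e where "e = \<epsilon> / s"
  have "e > 0" using \<open>\<epsilon> > 0\<close> \<open>s > 0\<close> by (simp add: e_def)

  obtain r\<^sub>1 w\<^sub>1 where r1: "r\<^sub>1 > 0" and w1: "integrable F w\<^sub>1" "(\<integral>z. w\<^sub>1 z \<partial>F) < e"
    "\<And>z \<theta>. \<theta> \<in> \<Theta> \<inter> ball \<theta>\<^sub>0 r\<^sub>1 \<Longrightarrow> \<bar>p\<^sub>2 z * norm (\<phi> z \<theta> - \<phi> z \<theta>\<^sub>0)\<bar> \<le> w\<^sub>1 z"
    using uniform_local_bound_\<phi>[OF meas_p\<^sub>2 p2 pm \<open>e > 0\<close>] by blast
  have mp: "integrable F (\<lambda>z. m\<^sub>0 z * p\<^sub>2 z)" using pm by (simp add: mult.commute)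
  \<comment> \<open>The weight is \<open>m\<^sub>0\<close> because the displacement it will be
    multiplied with is of size \<open>2 * K * m\<^sub>0 z / N\<close>.\<close>
  obtain r\<^sub>2 w\<^sub>2 where r2: "r\<^sub>2 > 0" and w2: "integrable F w\<^sub>2" "(\<integral>z. w\<^sub>2 z \<partial>F) < e" "\<And>z. 0 \<le> w\<^sub>2 z"
    "\<And>z x y. x \<in> ball \<theta>\<^sub>0 r\<^sub>2 \<Longrightarrow> y \<in> ball \<theta>\<^sub>0 r\<^sub>2 \<Longrightarrow>
       m\<^sub>0 z * \<bar>\<psi> z x - \<psi> z y - grad\<psi> z \<theta>\<^sub>0 \<bullet> (x - y)\<bar> \<le> w\<^sub>2 z * norm (x - y)"
    using uniform_strict_differentiability[OF interior meas_\<psi> deriv_\<psi> cont_grad\<psi> bound_grad\<psi> m\<^sub>0_nonneg meas_m\<^sub>0 mp \<open>e > 0\<close>]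
    by blast

  have summand: "\<bar>\<psi> z x - \<psi> z y + q z / N\<bar> \<le> (2 * K * w\<^sub>2 z + e * (p\<^sub>2 z * m\<^sub>0 z) + K * w\<^sub>1 z) / N"
    if N: "N > 0" and x: "x \<in> \<Theta>" "x \<in> ball \<theta>\<^sub>0 r\<^sub>1" "x \<in> ball \<theta>\<^sub>0 r\<^sub>2" and y: "y \<in> ball \<theta>\<^sub>0 r\<^sub>2"
      and a: "N * norm (x - y) \<le> 2 * K * m\<^sub>0 z"
      and b: "norm (B *v \<phi> z x + N *\<^sub>R (x - y)) \<le> e * m\<^sub>0 z" for z x y and N :: real
  proof -
    define g where "g = grad\<psi> z \<theta>\<^sub>0"
    have g: "norm g \<le> p\<^sub>2 z" unfolding g_def by (rule bound_grad\<psi>[OF \<theta>\<^sub>0_mem])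
    have 1: "N * \<bar>\<psi> z x - \<psi> z y - g \<bullet> (x - y)\<bar> \<le> 2 * K * w\<^sub>2 z"
    proof (cases "x = y")
      case True
      then show ?thesis using K(1) w2(3)[of z] by simp
    next
      case False
      \<comment> \<open>The displacement bound is spent on the factor \<open>norm (x - y)\<close>
        first, producing the weight \<open>m\<^sub>0 z\<close>; strict differentiability then
        returns a factor \<open>norm (x - y)\<close> that cancels.\<close>
      define R where "R = \<bar>\<psi> z x - \<psi> z y - g \<bullet> (x - y)\<bar>"
      have "N * norm (x - y) * R \<le> 2 * K * m\<^sub>0 z * R"
        using a by (rule mult_right_mono) (simp add: R_def)
      also have "\<dots> \<le> 2 * K * (w\<^sub>2 z * norm (x - y))"
        using w2(4)[OF x(3) y, of z] K(1) by (simp add: R_def g_def)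
      finally have "(N * R) * norm (x - y) \<le> (2 * K * w\<^sub>2 z) * norm (x - y)"
        by (simp add: mult_ac)
      then show ?thesis using False unfolding R_def by simp
    qed
    have 2: "\<bar>g \<bullet> (B *v \<phi> z x + N *\<^sub>R (x - y))\<bar> \<le> e * (p\<^sub>2 z * m\<^sub>0 z)"
    proof -
      have "\<bar>g \<bullet> (B *v \<phi> z x + N *\<^sub>R (x - y))\<bar> \<le> p\<^sub>2 z * (e * m\<^sub>0 z)"
        by (rule order_trans[OF Cauchy_Schwarz_ineq2 mult_mono[OF g b]]) (use p2 in auto)
      then show ?thesis by (simp add: mult_ac)
    qed
    have 3: "\<bar>g \<bullet> (B *v (\<phi> z x - \<phi> z \<theta>\<^sub>0))\<bar> \<le> K * w\<^sub>1 z"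
    proof -
      have "\<bar>g \<bullet> (B *v (\<phi> z x - \<phi> z \<theta>\<^sub>0))\<bar> \<le> p\<^sub>2 z * (K * norm (\<phi> z x - \<phi> z \<theta>\<^sub>0))"
        by (rule order_trans[OF Cauchy_Schwarz_ineq2 mult_mono[OF g K(2)]]) (use p2 in auto)
      also have "\<dots> = K * (p\<^sub>2 z * norm (\<phi> z x - \<phi> z \<theta>\<^sub>0))" by (simp add: mult_ac)
      also have "\<dots> \<le> K * w\<^sub>1 z"
        using w1(3)[of x z] x K(1) by (intro mult_left_mono) auto
      finally show ?thesis .
    qed
    have absN: "N * \<bar>t\<bar> = \<bar>N * t\<bar>" for t using N by (simp add: abs_mult)
    \<comment> \<open>The three terms are the errors of linearising \<open>\<psi>\<close>, of
      approximating the displacement, and of evaluating \<open>\<phi>\<close> at \<open>x\<close>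
      instead of \<open>\<theta>\<^sub>0\<close>.\<close>
    have "N * (\<psi> z x - \<psi> z y + q z / N) = N * (\<psi> z x - \<psi> z y - g \<bullet> (x - y))
        + g \<bullet> (B *v \<phi> z x + N *\<^sub>R (x - y)) - g \<bullet> (B *v (\<phi> z x - \<phi> z \<theta>\<^sub>0))"
      using N by (simp add: q_def g_def algebra_simps inner_add_right inner_diff_right
          matrix_vector_mult_diff_distrib)
    then have "N * \<bar>\<psi> z x - \<psi> z y + q z / N\<bar>
        \<le> N * \<bar>\<psi> z x - \<psi> z y - g \<bullet> (x - y)\<bar> + \<bar>g \<bullet> (B *v \<phi> z x + N *\<^sub>R (x - y))\<bar>
          + \<bar>g \<bullet> (B *v (\<phi> z x - \<phi> z \<theta>\<^sub>0))\<bar>"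
      unfolding absN by linarith
    also have "\<dots> \<le> 2 * K * w\<^sub>2 z + e * (p\<^sub>2 z * m\<^sub>0 z) + K * w\<^sub>1 z"
      using 1 2 3 by linarith
    finally show ?thesis using N by (simp add: pos_le_divide_eq mult.commute)
  qed

  define \<delta> where "\<delta> = min r\<^sub>1 r\<^sub>2"
  have "\<delta> > 0" using r1 r2 by (simp add: \<delta>_def)
  have "whp (\<lambda>n \<omega>. ((\<theta>hat n \<omega> \<in> ball \<theta>\<^sub>0 \<delta> \<and> (\<forall>i<n. \<theta>loo n i \<omega> \<in> ball \<theta>\<^sub>0 \<delta>)) \<and>
      (\<forall>i<n. real n * norm (\<theta>loo n i \<omega> - \<theta>hat n \<omega>) \<le> 2 * K * m\<^sub>0 (Z i \<omega>) \<and>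
        norm (B *v \<phi> (Z i \<omega>) (\<theta>loo n i \<omega>) + real n *\<^sub>R (\<theta>loo n i \<omega> - \<theta>hat n \<omega>)) \<le> e * m\<^sub>0 (Z i \<omega>))) \<and>
      mean w\<^sub>1 n \<omega> < e \<and> mean w\<^sub>2 n \<omega> < e \<and> mean (\<lambda>z. p\<^sub>2 z * m\<^sub>0 z) n \<omega> < E \<and>
      \<bar>mean q n \<omega> - (\<integral>z. q z \<partial>F)\<bar> \<le> e)"
    by (intro whp_conj consistency whp_loo_displacement whp_mean_less weak_law_of_large_numbers
        B K \<open>e > 0\<close> \<open>\<delta> > 0\<close> w1(1,2) w2(1,2) pm q(1)) (simp add: E_def)
  then show ?thesis
    unfolding B_def[symmetric] \<tau>_def[symmetric]
  proof (rule whp_eventually_mono)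
    have "\<bar>(\<Sum>i<n. \<psi> (Z i \<omega>) (\<theta>loo n i \<omega>) - \<psi> (Z i \<omega>) (\<theta>hat n \<omega>)) + \<tau>\<bar> \<le> \<epsilon>"
      if n: "n \<ge> 1" and \<omega>: "\<omega> \<in> space M"
        and hat: "\<theta>hat n \<omega> \<in> ball \<theta>\<^sub>0 \<delta>" and loo: "\<And>i. i < n \<Longrightarrow> \<theta>loo n i \<omega> \<in> ball \<theta>\<^sub>0 \<delta>"
        and D1: "\<And>i. i < n \<Longrightarrow> real n * norm (\<theta>loo n i \<omega> - \<theta>hat n \<omega>) \<le> 2 * K * m\<^sub>0 (Z i \<omega>)"
        and D2: "\<And>i. i < n \<Longrightarrow>
          norm (B *v \<phi> (Z i \<omega>) (\<theta>loo n i \<omega>) + real n *\<^sub>R (\<theta>loo n i \<omega> - \<theta>hat n \<omega>)) \<le> e * m\<^sub>0 (Z i \<omega>)"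
        and m1: "mean w\<^sub>1 n \<omega> < e" and m2: "mean w\<^sub>2 n \<omega> < e"
        and m3: "mean (\<lambda>z. p\<^sub>2 z * m\<^sub>0 z) n \<omega> < E" and mq: "\<bar>mean q n \<omega> - (\<integral>z. q z \<partial>F)\<bar> \<le> e" for n \<omega>
    proof -
      define S where "S = (\<Sum>i<n. \<psi> (Z i \<omega>) (\<theta>loo n i \<omega>) - \<psi> (Z i \<omega>) (\<theta>hat n \<omega>))"
      have "S + mean q n \<omega> = (\<Sum>i<n. \<psi> (Z i \<omega>) (\<theta>loo n i \<omega>) - \<psi> (Z i \<omega>) (\<theta>hat n \<omega>) + q (Z i \<omega>) / n)"
        by (simp add: S_def mean_def sum.distrib sum_divide_distrib)
      also have "\<bar>\<dots>\<bar> \<le> (\<Sum>i<n. (2 * K * w\<^sub>2 (Z i \<omega>) + e * (p\<^sub>2 (Z i \<omega>) * m\<^sub>0 (Z i \<omega>)) + K * w\<^sub>1 (Z i \<omega>)) / n)"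
      proof (rule order_trans[OF sum_abs sum_mono])
        fix i assume "i \<in> {..<n}"
        then have i: "i < n" by simp
        have "\<theta>loo n i \<omega> \<in> ball \<theta>\<^sub>0 r\<^sub>1" "\<theta>loo n i \<omega> \<in> ball \<theta>\<^sub>0 r\<^sub>2" "\<theta>hat n \<omega> \<in> ball \<theta>\<^sub>0 r\<^sub>2"
          using loo[OF i] hat by (auto simp: \<delta>_def)
        then show "\<bar>\<psi> (Z i \<omega>) (\<theta>loo n i \<omega>) - \<psi> (Z i \<omega>) (\<theta>hat n \<omega>) + q (Z i \<omega>) / n\<bar>
          \<le> (2 * K * w\<^sub>2 (Z i \<omega>) + e * (p\<^sub>2 (Z i \<omega>) * m\<^sub>0 (Z i \<omega>)) + K * w\<^sub>1 (Z i \<omega>)) / n"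
          using n by (intro summand loo_estimator i \<omega> D1 D2) auto
      qed
      also have "\<dots> = 2 * K * mean w\<^sub>2 n \<omega> + e * mean (\<lambda>z. p\<^sub>2 z * m\<^sub>0 z) n \<omega> + K * mean w\<^sub>1 n \<omega>"
        by (simp add: mean_def sum.distrib sum_divide_distrib[symmetric] sum_distrib_left[symmetric]
            add_divide_distrib)
      also have "\<dots> \<le> 2 * K * e + e * E + K * e"
        using m1 m2 m3 K(1) \<open>e > 0\<close> by (intro add_mono mult_left_mono) auto
      finally have "\<bar>S + mean q n \<omega>\<bar> \<le> 2 * K * e + e * E + K * e" .
      then have "\<bar>S + \<tau>\<bar> \<le> 2 * K * e + e * E + K * e + e"
        using mq unfolding q(2) by linarith
      also have "\<dots> = s * e" by (simp add: s_def algebra_simps)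
      also have "\<dots> = \<epsilon>" using \<open>s > 0\<close> by (simp add: e_def)
      finally show ?thesis unfolding S_def .
    qed
    then show "\<forall>\<^sub>F n in sequentially. \<forall>\<omega>\<in>space M.
      ((\<theta>hat n \<omega> \<in> ball \<theta>\<^sub>0 \<delta> \<and> (\<forall>i<n. \<theta>loo n i \<omega> \<in> ball \<theta>\<^sub>0 \<delta>)) \<and>
      (\<forall>i<n. real n * norm (\<theta>loo n i \<omega> - \<theta>hat n \<omega>) \<le> 2 * K * m\<^sub>0 (Z i \<omega>) \<and>
        norm (B *v \<phi> (Z i \<omega>) (\<theta>loo n i \<omega>) + real n *\<^sub>R (\<theta>loo n i \<omega> - \<theta>hat n \<omega>)) \<le> e * m\<^sub>0 (Z i \<omega>))) \<and>
      mean w\<^sub>1 n \<omega> < e \<and> mean w\<^sub>2 n \<omega> < e \<and> mean (\<lambda>z. p\<^sub>2 z * m\<^sub>0 z) n \<omega> < E \<and>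
      \<bar>mean q n \<omega> - (\<integral>z. q z \<partial>F)\<bar> \<le> e \<longrightarrow>
      \<bar>(\<Sum>i<n. \<psi> (Z i \<omega>) (\<theta>loo n i \<omega>) - \<psi> (Z i \<omega>) (\<theta>hat n \<omega>)) + \<tau>\<bar> \<le> \<epsilon>"
      by (intro eventually_mono[OF eventually_ge_at_top[of 1]]) blast
  qed
qed

end

section \<open>Moments of the envelopes and the final expansion\<close>

text \<open>Measurability of an envelope is recovered from the integrability of its power by taking
  a continuous root.\<close>

lemma borel_measurable_of_power:
  fixes f :: "'a \<Rightarrow> real"
  assumes "(\<lambda>x. f x ^ k) \<in> borel_measurable M" "\<And>x. 0 \<le> f x" "k > 0"
  shows "f \<in> borel_measurable M"
proof -
  have "continuous_on UNIV (root k)"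
    by (intro continuous_on_real_root continuous_on_id)
  from borel_measurable_continuous_on[OF this assms(1)] show ?thesis
    using assms(2,3) by (simp add: real_root_power_cancel)
qed

text \<open>The square of \<open>(f x)\<^sup>2 - 1\<close> is nonnegative, so
  \<open>1 + f x ^ 4\<close> dominates; its constant is integrable because the measure is
  finite.\<close>

lemma (in finite_measure) integrable_power2_of_power4:
  fixes f :: "'a \<Rightarrow> real"
  assumes [measurable]: "f \<in> borel_measurable M" and int: "integrable M (\<lambda>x. f x ^ 4)"
  shows "integrable M (\<lambda>x. (f x)\<^sup>2)"
proof (rule Bochner_Integration.integrable_bound)
  show "integrable M (\<lambda>x. 1 + f x ^ 4)"
    using int by simp
  have "(f x)\<^sup>2 \<le> 1 + f x ^ 4" for x
  proof -
    have "0 \<le> ((f x)\<^sup>2 - 1)\<^sup>2" by simp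
    then have "2 * (f x)\<^sup>2 \<le> 1 + f x ^ 4" by (simp add: power2_diff power_mult[symmetric])
    then show ?thesis using zero_le_power2[of "f x"] by linarith
  qed
  then show "AE x in M. norm ((f x)\<^sup>2) \<le> norm (1 + f x ^ 4)"
    by (simp add: order_trans[OF _ abs_ge_self])
qed measurable

text \<open>Observations are numbered from 0, and \<open>\<theta>loo n i\<close> omits observation
  \<open>i\<close> among the first \<open>n\<close>. Derivatives are taken within
  \<open>\<Theta>\<close> so that boundary points make sense; at the interior point
  \<open>\<theta>\<^sub>0\<close> they are ordinary ones. Columns of \<open>D\<phi>\<close> are the
  partial derivatives.\<close>

theorem theorem6:
  fixes M :: "'w measure"
    and F :: "(real^'d) measure"
    and Z :: "nat \<Rightarrow> 'w \<Rightarrow> real^'d"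
    and \<Theta> :: "(real^'p) set"
    and \<phi> :: "real^'d \<Rightarrow> real^'p \<Rightarrow> real^'p"
    and D\<phi> :: "real^'d \<Rightarrow> real^'p \<Rightarrow> real^'p^'p"
    and \<psi> :: "real^'d \<Rightarrow> real^'p \<Rightarrow> real"
    and grad\<psi> :: "real^'d \<Rightarrow> real^'p \<Rightarrow> real^'p"
    and DE\<phi> :: "real^'p \<Rightarrow> real^'p^'p"
    and m\<^sub>0 m\<^sub>1 p\<^sub>1 p\<^sub>2 :: "real^'d \<Rightarrow> real"
    and \<theta>\<^sub>0 :: "real^'p"
    and \<theta>hat :: "nat \<Rightarrow> 'w \<Rightarrow> real^'p"
    and \<theta>loo :: "nat \<Rightarrow> nat \<Rightarrow> 'w \<Rightarrow> real^'p"
    and J C :: "real^'p^'p"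
  assumes "prob_space M"
    and indep: "prob_space.indep_vars M (\<lambda>_. borel) Z UNIV"
    and ident: "\<And>i. distr M borel (Z i) = F"
    and compact: "compact \<Theta>"
    and meas_\<phi>: "\<And>\<theta>. \<theta> \<in> \<Theta> \<Longrightarrow> (\<lambda>z. \<phi> z \<theta>) \<in> borel_measurable borel"
    and meas_\<psi>: "\<And>\<theta>. \<theta> \<in> \<Theta> \<Longrightarrow> (\<lambda>z. \<psi> z \<theta>) \<in> borel_measurable borel"
    and deriv_\<phi>: "\<And>z \<theta>. \<theta> \<in> \<Theta> \<Longrightarrow>
          (\<phi> z has_derivative (\<lambda>h. D\<phi> z \<theta> *v h)) (at \<theta> within \<Theta>)"
    and deriv_\<psi>: "\<And>z \<theta>. \<theta> \<in> \<Theta> \<Longrightarrow>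
          (\<psi> z has_derivative (\<lambda>h. grad\<psi> z \<theta> \<bullet> h)) (at \<theta> within \<Theta>)"
    and deriv_E\<phi>: "\<And>\<theta>. \<theta> \<in> \<Theta> \<Longrightarrow>
          ((\<lambda>\<theta>'. \<integral>z. \<phi> z \<theta>' \<partial>F) has_derivative (\<lambda>h. DE\<phi> \<theta> *v h)) (at \<theta> within \<Theta>)"
    and cont_D\<phi>: "\<And>z. isCont (D\<phi> z) \<theta>\<^sub>0"
    and cont_grad\<psi>: "\<And>z. isCont (grad\<psi> z) \<theta>\<^sub>0"
    and bound_\<phi>: "\<And>z \<theta>. \<theta> \<in> \<Theta> \<Longrightarrow> norm (\<phi> z \<theta>) \<le> m\<^sub>0 z"
    and bound_D\<phi>: "\<And>z \<theta> k. \<theta> \<in> \<Theta> \<Longrightarrow> norm (column k (D\<phi> z \<theta>)) \<le> m\<^sub>1 z"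
    and bound_\<psi>: "\<And>z \<theta>. \<theta> \<in> \<Theta> \<Longrightarrow> \<bar>\<psi> z \<theta>\<bar> \<le> p\<^sub>1 z"
    and bound_grad\<psi>: "\<And>z \<theta> k. \<theta> \<in> \<Theta> \<Longrightarrow> \<bar>grad\<psi> z \<theta> $ k\<bar> \<le> p\<^sub>2 z"
    and moment_m\<^sub>0: "integrable F (\<lambda>z. m\<^sub>0 z ^ 4)"
    and moment_m\<^sub>1: "integrable F (\<lambda>z. m\<^sub>1 z ^ 4)"
    and moment_p\<^sub>1: "integrable F (\<lambda>z. p\<^sub>1 z ^ 4)"
    and moment_p\<^sub>2: "integrable F (\<lambda>z. p\<^sub>2 z ^ 2)"
    and interior: "\<theta>\<^sub>0 \<in> interior \<Theta>"
    and root: "\<And>\<theta>. \<theta> \<in> \<Theta> \<Longrightarrow> (\<integral>z. \<phi> z \<theta> \<partial>F) = 0 \<longleftrightarrow> \<theta> = \<theta>\<^sub>0"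
    and invertible: "\<And>\<theta>. \<theta> \<in> \<Theta> \<Longrightarrow> invertible (DE\<phi> \<theta>)"
    and eigenvalues: "\<exists>K. \<forall>\<theta>\<in>\<Theta>. \<forall>c. complex_eigenvalue (matrix_inv (DE\<phi> \<theta>)) c \<longrightarrow> cmod c \<le> K"
    and estimator: "\<And>n. n \<ge> 1 \<Longrightarrow> \<theta>hat n \<in> M \<rightarrow>\<^sub>M restrict_space borel \<Theta>"
    and loo_estimator: "\<And>n i. i < n \<Longrightarrow> \<theta>loo n i \<in> M \<rightarrow>\<^sub>M restrict_space borel \<Theta>"
    and estimating_eq: "\<forall>\<^sub>F n in sequentially. AE \<omega> in M. (\<Sum>j<n. \<phi> (Z j \<omega>) (\<theta>hat n \<omega>)) = 0"
    and loo_estimating_eq: "\<forall>\<^sub>F n in sequentially. \<forall>i<n. AE \<omega> in M.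
          (\<Sum>j\<in>{..<n} - {i}. \<phi> (Z j \<omega>) (\<theta>loo n i \<omega>)) = 0"
    and J: "J = - DE\<phi> \<theta>\<^sub>0"
    and C: "C = (\<integral>z. (\<chi> a b. \<phi> z \<theta>\<^sub>0 $ a * grad\<psi> z \<theta>\<^sub>0 $ b) \<partial>F)"
  shows "small_o_p M
     (\<lambda>n \<omega>. (1 / real n) * (\<Sum>i<n. \<psi> (Z i \<omega>) (\<theta>loo n i \<omega>))
            - ((1 / real n) * (\<Sum>i<n. \<psi> (Z i \<omega>) (\<theta>hat n \<omega>))
               - (1 / real n) * trace (matrix_inv J ** C)))
     (\<lambda>n. 1 / real n)"
proof -
  interpret prob_space M by fact
  \<comment> \<open>\<open>F\<close> is a pushforward onto the Borel sets, so it may replace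
    \<open>borel\<close> as target space, as \<open>iid_sample\<close> requires.\<close>
  have sets_F: "sets F = sets borel"
    using ident[of 0] by (metis sets_distr)
  have iid: "iid_sample M F Z"
  proof
    show "indep_vars (\<lambda>_. F) Z UNIV"
      using indep unfolding indep_vars_def2 by (simp add: sets_F measurable_cong_sets[OF refl sets_F])
    show "distr M F (Z i) = F" for i
      using ident[of i] distr_cong[OF refl sets_F, of M "Z i" "Z i"] by simp
  qed
  interpret S: iid_sample M F Z by (rule iid)
  have \<theta>\<^sub>0: "\<theta>\<^sub>0 \<in> \<Theta>" using interior interior_subset by blast
  have m0: "0 \<le> m\<^sub>0 z" for z by (rule order_trans[OF norm_ge_zero bound_\<phi>[OF \<theta>\<^sub>0]])
  have m1: "0 \<le> m\<^sub>1 z" for z by (rule order_trans[OF norm_ge_zero bound_D\<phi>[OF \<theta>\<^sub>0]])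
  have p2: "0 \<le> p\<^sub>2 z" for z by (rule order_trans[OF abs_ge_zero bound_grad\<psi>[OF \<theta>\<^sub>0]])
  have meas_m0: "m\<^sub>0 \<in> borel_measurable F"
    by (rule borel_measurable_of_power[OF borel_measurable_integrable[OF moment_m\<^sub>0] m0]) simp
  have meas_m1: "m\<^sub>1 \<in> borel_measurable F"
    by (rule borel_measurable_of_power[OF borel_measurable_integrable[OF moment_m\<^sub>1] m1]) simp
  have meas_p2: "p\<^sub>2 \<in> borel_measurable F"
    by (rule borel_measurable_of_power[OF borel_measurable_integrable[OF moment_p\<^sub>2] p2]) simp
  have meas_F: "f \<in> borel_measurable F" if "f \<in> borel_measurable borel"
    for f :: "real^'d \<Rightarrow> 'b::topological_space"
    using that by (simp add: measurable_cong_sets[OF sets_F refl])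
  have int_m1: "integrable F m\<^sub>1"
    using integrable_mult_of_squares[OF meas_m1 _ S.F.integrable_power2_of_power4[OF meas_m1 moment_m\<^sub>1], of "\<lambda>_. 1"]
    by simp
  have hat: "\<theta>hat n \<omega> \<in> \<Theta>" if "n \<ge> 1" "\<omega> \<in> space M" for n \<omega>
    using measurable_space[OF estimator[OF that(1)] that(2)] by (simp add: space_restrict_space)
  have loo: "\<theta>loo n i \<omega> \<in> \<Theta>" if "i < n" "\<omega> \<in> space M" for n i \<omega>
    using measurable_space[OF loo_estimator[OF that(1)] that(2)] by (simp add: space_restrict_space)
  interpret E: M_estimation M F Z \<Theta> \<phi> D\<phi> "DE\<phi> \<theta>\<^sub>0" \<theta>\<^sub>0 m\<^sub>0 m\<^sub>1 \<theta>hat \<theta>loo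
  proof
    show "((\<lambda>\<theta>. \<integral>z. \<phi> z \<theta> \<partial>F) has_derivative (\<lambda>h. DE\<phi> \<theta>\<^sub>0 *v h)) (at \<theta>\<^sub>0)"
      using deriv_E\<phi>[OF \<theta>\<^sub>0] by (simp only: at_within_interior[OF interior])
    show "integrable F (\<lambda>z. (m\<^sub>0 z)\<^sup>2)"
      by (rule S.F.integrable_power2_of_power4[OF meas_m0 moment_m\<^sub>0])
    show "(\<lambda>z. \<phi> z \<theta>) \<in> borel_measurable F" if "\<theta> \<in> \<Theta>" for \<theta>
      by (rule meas_F[OF meas_\<phi>[OF that]])
    show "invertible (DE\<phi> \<theta>\<^sub>0)" by (rule invertible[OF \<theta>\<^sub>0])
  qed (fact compact interior deriv_\<phi> cont_D\<phi> bound_\<phi> bound_D\<phi> meas_m0 int_m1 root hat loo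
      estimating_eq loo_estimating_eq)+
  define \<tau> where "\<tau> = trace (matrix_inv J ** C)"
  have expansion: "whp (\<lambda>n \<omega>. \<bar>(\<Sum>i<n. \<psi> (Z i \<omega>) (\<theta>loo n i \<omega>) - \<psi> (Z i \<omega>) (\<theta>hat n \<omega>)) + \<tau>\<bar> \<le> \<epsilon>)"
    if "\<epsilon> > 0" for \<epsilon>
    unfolding \<tau>_def J C
  proof (rule E.whp_loo_expansion)
    show "(\<lambda>z. \<psi> z \<theta>) \<in> borel_measurable F" if "\<theta> \<in> \<Theta>" for \<theta>
      by (rule meas_F[OF meas_\<psi>[OF that]])
    \<comment> \<open>The envelope bounds single partial derivatives, whereas the expansion needs
      the norm of the gradient.\<close>
    show "norm (grad\<psi> z \<theta>) \<le> CARD('p) * p\<^sub>2 z" if "\<theta> \<in> \<Theta>" for z \<theta>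
      by (rule norm_le_CARD_mult[OF bound_grad\<psi>[OF that]])
    show "(\<lambda>z. CARD('p) * p\<^sub>2 z) \<in> borel_measurable F"
      using meas_p2 by measurable
    show "integrable F (\<lambda>z. (CARD('p) * p\<^sub>2 z)\<^sup>2)"
      using moment_p\<^sub>2 by (simp add: power_mult_distrib)
  qed (fact deriv_\<psi> cont_grad\<psi> that)+
  have cont_\<psi>: "continuous_on \<Theta> (\<psi> z)" for z
    using deriv_\<psi> by (rule has_derivative_continuous_on)
  note meas_plug_in = borel_measurable_Caratheodory[OF meas_F[OF meas_\<psi>] cont_\<psi> S.measurable_Z]
  show ?thesis
    unfolding small_o_p_def \<tau>_def[symmetric]
  proof (intro conjI allI impI)
    fix n
    \<comment> \<open>The condition \<open>i < n\<close> supplies the \<open>n \<ge> 1\<close> under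
      which \<open>\<theta>hat n\<close> is constrained; for \<open>n = 0\<close> the sums are
      empty.\<close>
    have "(\<lambda>\<omega>. \<psi> (Z i \<omega>) (\<theta>loo n i \<omega>)) \<in> borel_measurable M"
      "(\<lambda>\<omega>. \<psi> (Z i \<omega>) (\<theta>hat n \<omega>)) \<in> borel_measurable M" if "i < n" for i
      using that by (auto intro!: meas_plug_in loo_estimator estimator)
    then show "(\<lambda>\<omega>. 1 / real n * (\<Sum>i<n. \<psi> (Z i \<omega>) (\<theta>loo n i \<omega>))
        - (1 / real n * (\<Sum>i<n. \<psi> (Z i \<omega>) (\<theta>hat n \<omega>)) - 1 / real n * \<tau>)) \<in> borel_measurable M"
      by (intro borel_measurable_diff borel_measurable_times borel_measurable_sum borel_measurable_const) auto
  next
    fix \<epsilon> :: real assume "\<epsilon> > 0"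
    \<comment> \<open>Both sides carry the factor \<open>1 / real n\<close>, so the comparison
      reduces to the bound of the expansion.\<close>
    have scaled: "\<not> \<epsilon> * \<bar>1 / real n\<bar> < \<bar>1 / real n * a - (1 / real n * b - 1 / real n * \<tau>)\<bar>"
      if "n \<ge> 1" "\<bar>a - b + \<tau>\<bar> \<le> \<epsilon>" for n :: nat and a b
    proof -
      have "1 / real n * a - (1 / real n * b - 1 / real n * \<tau>) = (a - b + \<tau>) / n"
        by (simp add: diff_divide_distrib add_divide_distrib)
      then show ?thesis
        using that by (simp add: abs_divide divide_right_mono not_less)
    qed
    show "(\<lambda>n. prob {\<omega> \<in> space M. \<epsilon> * \<bar>1 / real n\<bar> < \<bar>1 / real n * (\<Sum>i<n. \<psi> (Z i \<omega>) (\<theta>loo n i \<omega>))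
        - (1 / real n * (\<Sum>i<n. \<psi> (Z i \<omega>) (\<theta>hat n \<omega>)) - 1 / real n * \<tau>)\<bar>}) \<longlonglongrightarrow> 0"
    proof (rule whp_imp_prob_tendsto_0, rule whp_eventually_mono[OF expansion[OF \<open>\<epsilon> > 0\<close>]])
      show "\<forall>\<^sub>F n in sequentially. \<forall>\<omega>\<in>space M.
        \<bar>(\<Sum>i<n. \<psi> (Z i \<omega>) (\<theta>loo n i \<omega>) - \<psi> (Z i \<omega>) (\<theta>hat n \<omega>)) + \<tau>\<bar> \<le> \<epsilon> \<longrightarrow>
        \<not> \<epsilon> * \<bar>1 / real n\<bar> < \<bar>1 / real n * (\<Sum>i<n. \<psi> (Z i \<omega>) (\<theta>loo n i \<omega>))
          - (1 / real n * (\<Sum>i<n. \<psi> (Z i \<omega>) (\<theta>hat n \<omega>)) - 1 / real n * \<tau>)\<bar>"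
        unfolding sum_subtractf
        by (intro eventually_mono[OF eventually_ge_at_top[of 1]] ballI impI scaled) auto
    qed
  qed
qed

end
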